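(* Let $\mathrm{uAs}_c$ be the cyclic associative operad. Then $\mathrm{Tw}_{\mathrm{cOp}}(\mathrm{uAs}_c)$ is equivalent to Connes' cyclic category $\Lambda$.
   Context: A cyclic operad $P$ (in sets, single-coloured) is a symmetric operad whose $S_n$-action on $P(n)$ extends compatibly with composition to an action of $S_{n+1}$; elements of $P(n)$, $n\ge0$, are thought of as having legs $0,\dots,n$, and the partial composition $p\circ_i q$ glues leg $i$ of $p$ to leg $0$ of $q$; more generally, any leg of one element can be glued to any leg of another one, provided the result has at least one leg. The twisted arrow category $\mathrm{Tw}_{\mathrm{cOp}}(P)$: objects are the elements of all sets $P(n)$, $n\ge 0$. A morphism with source $p\in P(n)$ is a tuple $(q_0,\dots,q_n;\lambda)$, where $q_j\in P(m_j)$, $\sum_j m_j\ge1$, and $\lambda$ is a bijection from $\{(j,k):0\le j\le n,1\le k\le m_j\}$ onto $\{0,\dots,N\}$ (so $N+1=\sum_j m_j$) such that $k\mapsto\lambda(j,k)$ is increasing for each fixed $j$. Its target is the element of $P(N)$ obtained by gluing leg $0$ of $q_j$ to leg $j$ of $p$ for all $j$ and numbering the remaining legs (leg $k$ of $q_j$ by $\lambda(j,k)$). The composite of $(q_0,\dots,q_n;\lambda):p\to t$ with $(r_0,\dots,r_N;\mu):t\to u$ is obtained by gluing leg $0$ of $r_{\lambda(j,k)}$ to leg $k$ of $q_j$, composing $q_j$ with all the $r_{\lambda(j,k)}$, $1\le k\le m_j$, and numbering the remaining legs by $\mu$ (the non-zero legs of each composite are renumbered so that the indices increase). The cyclic associative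 operad $\mathrm{uAs}_c$ is the symmetric operad of (unital) monoids with its standard cyclic structure: $\mathrm{uAs}_c(n)$, $n\ge0$, is the set of cyclic orders on $\{0,\dots,n\}$, $S_{n+1}$ acts by relabelling, and gluing of legs is the splicing of cyclic orders. *)

theory Defs
  imports "HOL-Combinatorics.Permutations" "HOL-Library.FuncSet"
begin

section \<open>Categories\<close>

text \<open>Hom-sets of different pairs of objects need not be disjoint, so functors act on a morphism
  together with its source and target.  Composition is written in the order of functions:
  \<open>Comp C g f\<close> is \<open>g\<close> after \<open>f\<close>.\<close>

record ('o, 'm) cat =
  Obj :: "'o set"
  Hom :: "'o \<Rightarrow> 'o \<Rightarrow> 'm set"
  Ident :: "'o \<Rightarrow> 'm"
  Comp :: "'m \<Rightarrow> 'm \<Rightarrow> 'm"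

locale category =
  fixes C :: "('o, 'm) cat"
  assumes Ident_in_Hom: "a \<in> Obj C \<Longrightarrow> Ident C a \<in> Hom C a a"
    and Comp_in_Hom:
      "\<lbrakk>a \<in> Obj C; b \<in> Obj C; c \<in> Obj C; f \<in> Hom C a b; g \<in> Hom C b c\<rbrakk> \<Longrightarrow> Comp C g f \<in> Hom C a c"
    and Comp_Ident: "\<lbrakk>a \<in> Obj C; b \<in> Obj C; f \<in> Hom C a b\<rbrakk> \<Longrightarrow> Comp C f (Ident C a) = f"
    and Ident_Comp: "\<lbrakk>a \<in> Obj C; b \<in> Obj C; f \<in> Hom C a b\<rbrakk> \<Longrightarrow> Comp C (Ident C b) f = f"
    and Comp_assoc:
      "\<lbrakk>a \<in> Obj C; b \<in> Obj C; c \<in> Obj C; d \<in> Obj C; f \<in> Hom C a b; g \<in> Hom C b c; h \<in> Hom C c d\<rbrakk>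
        \<Longrightarrow> Comp C (Comp C h g) f = Comp C h (Comp C g f)"

record ('o, 'm, 'p, 'n) func =
  FObj :: "'o \<Rightarrow> 'p"
  FHom :: "'o \<Rightarrow> 'o \<Rightarrow> 'm \<Rightarrow> 'n"

definition is_functor :: "('o, 'm) cat \<Rightarrow> ('p, 'n) cat \<Rightarrow> ('o, 'm, 'p, 'n) func \<Rightarrow> bool" where
  "is_functor C D F \<longleftrightarrow>
    (\<forall>a\<in>Obj C. FObj F a \<in> Obj D) \<and>
    (\<forall>a\<in>Obj C. \<forall>b\<in>Obj C. \<forall>f\<in>Hom C a b. FHom F a b f \<in> Hom D (FObj F a) (FObj F b)) \<and>
    (\<forall>a\<in>Obj C. FHom F a a (Ident C a) = Ident D (FObj F a)) \<and>
    (\<forall>a\<in>Obj C. \<forall>b\<in>Obj C. \<forall>c\<in>Obj C. \<forall>f\<in>Hom C a b. \<forall>g\<in>Hom C b c.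
       FHom F a c (Comp C g f) = Comp D (FHom F b c g) (FHom F a b f))"

definition id_func :: "('o, 'm, 'o, 'm) func" where
  "id_func = \<lparr>FObj = (\<lambda>a. a), FHom = (\<lambda>a b f. f)\<rparr>"

definition comp_func ::
    "('p, 'n, 'q, 'k) func \<Rightarrow> ('o, 'm, 'p, 'n) func \<Rightarrow> ('o, 'm, 'q, 'k) func" where
  "comp_func G F =
    \<lparr>FObj = (\<lambda>a. FObj G (FObj F a)),
     FHom = (\<lambda>a b f. FHom G (FObj F a) (FObj F b) (FHom F a b f))\<rparr>"

definition is_iso :: "('o, 'm) cat \<Rightarrow> 'o \<Rightarrow> 'o \<Rightarrow> 'm \<Rightarrow> bool" where
  "is_iso C a b f \<longleftrightarrow> f \<in> Hom C a b \<and>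
    (\<exists>g\<in>Hom C b a. Comp C g f = Ident C a \<and> Comp C f g = Ident C b)"

definition nat_iso ::
    "('o, 'm) cat \<Rightarrow> ('p, 'n) cat \<Rightarrow> ('o, 'm, 'p, 'n) func \<Rightarrow> ('o, 'm, 'p, 'n) func \<Rightarrow> ('o \<Rightarrow> 'n) \<Rightarrow> bool"
  where
  "nat_iso C D F G \<alpha> \<longleftrightarrow>
    (\<forall>a\<in>Obj C. is_iso D (FObj F a) (FObj G a) (\<alpha> a)) \<and>
    (\<forall>a\<in>Obj C. \<forall>b\<in>Obj C. \<forall>f\<in>Hom C a b.
       Comp D (\<alpha> b) (FHom F a b f) = Comp D (FHom G a b f) (\<alpha> a))"

definition equivalent_categories :: "('o, 'm) cat \<Rightarrow> ('p, 'n) cat \<Rightarrow> bool" where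
  "equivalent_categories C D \<longleftrightarrow> category C \<and> category D \<and>
    (\<exists>F G \<eta> \<epsilon>. is_functor C D F \<and> is_functor D C G \<and>
       nat_iso C C id_func (comp_func G F) \<eta> \<and> nat_iso D D (comp_func F G) id_func \<epsilon>)"


section \<open>Cyclic operads\<close>

text \<open>Elements of \<open>Ops P n\<close> have legs \<open>0, \<dots>, n\<close>.  For a permutation \<open>\<sigma>\<close> of \<open>{..n}\<close>, leg \<open>i\<close> of \<open>p\<close>
  becomes leg \<open>\<sigma> i\<close> of \<open>act P n \<sigma> p\<close>.  For \<open>p\<close> in \<open>Ops P m\<close>, \<open>q\<close> in \<open>Ops P n\<close> and \<open>1 \<le> i \<le> m\<close>,
  \<open>pcomp P m n i p q\<close> is the partial composition gluing leg \<open>i\<close> of \<open>p\<close> to leg \<open>0\<close> of \<open>q\<close>.\<close>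

record 'a operad =
  Ops :: "nat \<Rightarrow> 'a set"
  act :: "nat \<Rightarrow> (nat \<Rightarrow> nat) \<Rightarrow> 'a \<Rightarrow> 'a"
  unt :: 'a
  pcomp :: "nat \<Rightarrow> nat \<Rightarrow> nat \<Rightarrow> 'a \<Rightarrow> 'a \<Rightarrow> 'a"

text \<open>The leg of \<open>p\<close> (\<open>Inl\<close>) or of \<open>q\<close> (\<open>Inr\<close>) that becomes leg \<open>k\<close> of the composite of \<open>p\<close> and \<open>q\<close>
  at leg \<open>i\<close>, where \<open>q\<close> has arity \<open>n\<close>.\<close>

definition glued_leg :: "nat \<Rightarrow> nat \<Rightarrow> nat \<Rightarrow> nat + nat" where
  "glued_leg n i k =
    (if k < i then Inl k else if k < i + n then Inr (k - i + 1) else Inl (k + 1 - n))"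

text \<open>In \<open>pcomp_act\<close> the permutation \<open>\<sigma>\<close> may move leg \<open>0\<close>; for \<open>\<sigma> 0 = 0\<close> it is the equivariance of a
  symmetric operad.  \<open>pcomp_act_swap\<close> covers the relabellings that make leg \<open>i\<close> of \<open>p\<close> the
  leg \<open>0\<close>, so that \<open>p\<close> and \<open>q\<close> exchange their roles; for \<open>i = 1\<close> and \<open>\<sigma>\<close>, \<open>\<tau>\<close>, \<open>\<rho>\<close> the cyclic
  rotations it is the usual axiom for the cyclic permutation of \<open>p \<circ>\<^sub>1 q\<close>.\<close>

locale cyclic_operad =
  fixes P :: "'a operad"
  assumes act_closed: "\<lbrakk>p \<in> Ops P n; \<sigma> permutes {..n}\<rbrakk> \<Longrightarrow> act P n \<sigma> p \<in> Ops P n"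
    and act_id: "p \<in> Ops P n \<Longrightarrow> act P n id p = p"
    and act_comp: "\<lbrakk>p \<in> Ops P n; \<sigma> permutes {..n}; \<tau> permutes {..n}\<rbrakk>
      \<Longrightarrow> act P n (\<sigma> \<circ> \<tau>) p = act P n \<sigma> (act P n \<tau> p)"
    and unt_closed: "unt P \<in> Ops P 1"
    and act_unt: "\<sigma> permutes {..1} \<Longrightarrow> act P 1 \<sigma> (unt P) = unt P"
    and pcomp_closed: "\<lbrakk>p \<in> Ops P m; q \<in> Ops P n; 1 \<le> i; i \<le> m\<rbrakk>
      \<Longrightarrow> pcomp P m n i p q \<in> Ops P (m + n - 1)"
    and unt_pcomp: "p \<in> Ops P n \<Longrightarrow> pcomp P 1 n 1 (unt P) p = p"
    and pcomp_unt: "\<lbrakk>p \<in> Ops P m; 1 \<le> i; i \<le> m\<rbrakk> \<Longrightarrow> pcomp P m 1 i p (unt P) = p"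
    and pcomp_sequential:
      "\<lbrakk>p \<in> Ops P m; q \<in> Ops P n; r \<in> Ops P l; 1 \<le> i; i \<le> m; 1 \<le> j; j \<le> n\<rbrakk>
        \<Longrightarrow> pcomp P (m + n - 1) l (i + j - 1) (pcomp P m n i p q) r
          = pcomp P m (n + l - 1) i p (pcomp P n l j q r)"
    and pcomp_parallel:
      "\<lbrakk>p \<in> Ops P m; q \<in> Ops P n; r \<in> Ops P l; 1 \<le> i; i < k; k \<le> m\<rbrakk>
        \<Longrightarrow> pcomp P (m + n - 1) l (k + n - 1) (pcomp P m n i p q) r
          = pcomp P (m + l - 1) n i (pcomp P m l k p r) q"
    and pcomp_act:
      "\<lbrakk>p \<in> Ops P m; q \<in> Ops P n; 1 \<le> i; i \<le> m;
        \<sigma> permutes {..m}; \<tau> permutes {..n}; \<rho> permutes {..m + n - 1}; 1 \<le> \<sigma> i; \<tau> 0 = 0;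
        \<forall>k\<le>m + n - 1. glued_leg n (\<sigma> i) (\<rho> k) = map_sum \<sigma> \<tau> (glued_leg n i k)\<rbrakk>
        \<Longrightarrow> act P (m + n - 1) \<rho> (pcomp P m n i p q)
          = pcomp P m n (\<sigma> i) (act P m \<sigma> p) (act P n \<tau> q)"
    and pcomp_act_swap:
      "\<lbrakk>p \<in> Ops P m; q \<in> Ops P n; 1 \<le> i; i \<le> m;
        \<sigma> permutes {..m}; \<tau> permutes {..n}; \<rho> permutes {..m + n - 1}; \<sigma> i = 0; 1 \<le> \<tau> 0;
        \<forall>k\<le>m + n - 1. glued_leg m (\<tau> 0) (\<rho> k)
          = (case glued_leg n i k of Inl a \<Rightarrow> Inr (\<sigma> a) | Inr b \<Rightarrow> Inl (\<tau> b))\<rbrakk>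
        \<Longrightarrow> act P (m + n - 1) \<rho> (pcomp P m n i p q)
          = pcomp P n m (\<tau> 0) (act P n \<tau> q) (act P m \<sigma> p)"


section \<open>Gluing of legs\<close>

text \<open>To glue arbitrary legs, legs are given names: \<open>(p, ls)\<close> with \<open>distinct ls\<close> stands for an element
  \<open>p\<close> of arity \<open>length ls - 1\<close> whose leg \<open>i\<close> has the name \<open>ls ! i\<close>.  If \<open>ls'\<close> is a rearrangement of
  \<open>ls\<close>, then \<open>(reorder P ls' (p, ls), ls')\<close> is the same element with its legs numbered as in \<open>ls'\<close>.\<close>

definition reorder :: "'a operad \<Rightarrow> 'l list \<Rightarrow> 'a \<times> 'l list \<Rightarrow> 'a" where
  "reorder P ls' x = (case x of (p, ls) \<Rightarrow>
    act P (length ls - 1)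
      (\<lambda>i. if i < length ls then (THE k. k < length ls' \<and> ls' ! k = ls ! i) else i) p)"

text \<open>Two elements having exactly one leg name \<open>a\<close> in common are glued along \<open>a\<close>: the leg \<open>a\<close> is made
  the last leg of one of them and leg \<open>0\<close> of the other one.  The second case is needed when the
  first element has no other leg than \<open>a\<close>.  (If neither has another leg, the gluing is not
  defined and the value is meaningless.)\<close>

definition glue :: "'a operad \<Rightarrow> 'l \<Rightarrow> 'a \<times> 'l list \<Rightarrow> 'a \<times> 'l list \<Rightarrow> 'a \<times> 'l list" where
  "glue P a x y =
    (let ls = remove1 a (snd x); ks = remove1 a (snd y); m = length ls; n = length ks in
      if m > 0 then (pcomp P m n m (reorder P (ls @ [a]) x) (reorder P (a # ks) y), ls @ ks)
      else (pcomp P n m n (reorder P (ks @ [a]) y) (reorder P (a # ls) x), ks @ ls))"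

text \<open>\<open>glue_all P p js q \<beta>\<close>: leg \<open>0\<close> of \<open>q j\<close> is glued to leg \<open>j\<close> of \<open>p\<close> for all \<open>j\<close> in \<open>js\<close>.
  The remaining legs have the names \<open>(j, k)\<close> with \<open>k \<ge> 1\<close> (leg \<open>k\<close> of \<open>q j\<close>) and \<open>(j, 0)\<close> with \<open>j\<close>
  not in \<open>js\<close> (leg \<open>j\<close> of \<open>p\<close>); finally they are numbered by \<open>\<beta>\<close>.  Elements of the operad come
  as pairs \<open>(n, p)\<close> with \<open>p\<close> in \<open>Ops P n\<close>.\<close>

definition glue_all ::
    "'a operad \<Rightarrow> nat \<times> 'a \<Rightarrow> nat list \<Rightarrow> (nat \<Rightarrow> nat \<times> 'a) \<Rightarrow> (nat \<times> nat \<Rightarrow> nat) \<Rightarrow> nat \<times> 'a" where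
  "glue_all P p js q \<beta> =
    (let (x, ls) =
       fold (\<lambda>j y. glue P (j, 0) y (snd (q j), map (\<lambda>k. (j, k)) [0..<Suc (fst (q j))])) js
         (snd p, map (\<lambda>j. (j, 0)) [0..<Suc (fst p)])
     in (length ls - 1, reorder P [0..<length ls] (x, map \<beta> ls)))"


section \<open>The twisted arrow category of a cyclic operad\<close>

text \<open>A morphism \<open>(q\<^sub>0, \<dots>, q\<^sub>n; lam)\<close> is represented by the list of the pairs \<open>(m\<^sub>j, q\<^sub>j)\<close> and the
  function \<open>lam\<close>, which is \<open>undefined\<close> outside \<open>tw_legs\<close>.\<close>

type_synonym 'a tw_mor = "(nat \<times> 'a) list \<times> (nat \<times> nat \<Rightarrow> nat)"

definition tw_legs :: "(nat \<times> 'a) list \<Rightarrow> (nat \<times> nat) set" where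
  "tw_legs qs = {(j, k). j < length qs \<and> 1 \<le> k \<and> k \<le> fst (qs ! j)}"

definition tw_from :: "'a operad \<Rightarrow> nat \<times> 'a \<Rightarrow> 'a tw_mor set" where
  "tw_from P p = {(qs, lam).
    length qs = Suc (fst p) \<and> (\<forall>(m, q)\<in>set qs. q \<in> Ops P m) \<and> 1 \<le> sum_list (map fst qs) \<and>
    lam \<in> extensional (tw_legs qs) \<and> bij_betw lam (tw_legs qs) {..<sum_list (map fst qs)} \<and>
    (\<forall>j<length qs. strict_mono_on {1..fst (qs ! j)} (\<lambda>k. lam (j, k)))}"

definition tw_target :: "'a operad \<Rightarrow> nat \<times> 'a \<Rightarrow> 'a tw_mor \<Rightarrow> nat \<times> 'a" where
  "tw_target P p f = (case f of (qs, lam) \<Rightarrow> glue_all P p [0..<Suc (fst p)] (\<lambda>j. qs ! j) lam)"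

text \<open>\<open>tw_comp_nums f g j\<close> is the set of numbers that the composite of \<open>f = (q; lam)\<close> and \<open>g = (r; \<mu>)\<close>
  assigns to the non-zero legs of its \<open>j\<close>-th element, and \<open>tw_comp_elem P f g j\<close> is that element.\<close>

definition tw_comp_nums :: "'a tw_mor \<Rightarrow> 'a tw_mor \<Rightarrow> nat \<Rightarrow> nat set" where
  "tw_comp_nums f g j = (case (f, g) of ((qs, lam), (rs, \<mu>)) \<Rightarrow>
    {\<mu> (lam (j, k), l) | k l. 1 \<le> k \<and> k \<le> fst (qs ! j) \<and> 1 \<le> l \<and> l \<le> fst (rs ! lam (j, k))})"

definition tw_comp_elem :: "'a operad \<Rightarrow> 'a tw_mor \<Rightarrow> 'a tw_mor \<Rightarrow> nat \<Rightarrow> nat \<times> 'a" where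
  "tw_comp_elem P f g j = (case (f, g) of ((qs, lam), (rs, \<mu>)) \<Rightarrow>
    glue_all P (qs ! j) [1..<Suc (fst (qs ! j))] (\<lambda>k. rs ! lam (j, k))
      (\<lambda>(k, l). if k = 0 then 0 else card {x \<in> tw_comp_nums f g j. x \<le> \<mu> (lam (j, k), l)}))"

definition tw_comp :: "'a operad \<Rightarrow> 'a tw_mor \<Rightarrow> 'a tw_mor \<Rightarrow> 'a tw_mor" where
  "tw_comp P g f =
    (let ss = map (tw_comp_elem P f g) [0..<length (fst f)] in
      (ss, restrict (\<lambda>(j, i). sorted_list_of_set (tw_comp_nums f g j) ! (i - 1)) (tw_legs ss)))"

definition tw_ident :: "'a operad \<Rightarrow> nat \<times> 'a \<Rightarrow> 'a tw_mor" where
  "tw_ident P p =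
    (let qs = replicate (Suc (fst p)) (1, unt P) in (qs, restrict fst (tw_legs qs)))"

definition Tw_cOp :: "'a operad \<Rightarrow> (nat \<times> 'a, 'a tw_mor) cat" where
  "Tw_cOp P =
    \<lparr>Obj = {(n, p). p \<in> Ops P n},
     Hom = (\<lambda>p t. {f \<in> tw_from P p. tw_target P p f = t}),
     Ident = tw_ident P,
     Comp = tw_comp P\<rparr>"


section \<open>The cyclic associative operad\<close>

definition cyclic_order_on :: "'a set \<Rightarrow> ('a \<times> 'a \<times> 'a) set \<Rightarrow> bool" where
  "cyclic_order_on X R \<longleftrightarrow>
    R \<subseteq> X \<times> X \<times> X \<and>
    (\<forall>a b c. (a, b, c) \<in> R \<longrightarrow> (b, c, a) \<in> R) \<and>
    (\<forall>a b c. (a, b, c) \<in> R \<longrightarrow> (c, b, a) \<notin> R) \<and>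
    (\<forall>a b c d. (a, b, c) \<in> R \<and> (a, c, d) \<in> R \<longrightarrow> (a, b, d) \<in> R) \<and>
    (\<forall>a\<in>X. \<forall>b\<in>X. \<forall>c\<in>X. a \<noteq> b \<and> b \<noteq> c \<and> a \<noteq> c \<longrightarrow> (a, b, c) \<in> R \<or> (c, b, a) \<in> R)"

text \<open>Splicing replaces the leg \<open>i\<close> of the first cyclic order by the legs \<open>1, \<dots>, n\<close> of the second one,
  in their order after leg \<open>0\<close>.  Seen from the first order, all legs of the second one are at
  position \<open>i\<close>; seen from the second order, all legs of the first one are at position \<open>0\<close>.  Three
  legs of the result are in cyclic order iff they are so from one of the two points of view.\<close>

definition splice_fst :: "nat \<Rightarrow> nat \<Rightarrow> nat \<Rightarrow> nat" where
  "splice_fst n i k = (case glued_leg n i k of Inl a \<Rightarrow> a | Inr b \<Rightarrow> i)"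

definition splice_snd :: "nat \<Rightarrow> nat \<Rightarrow> nat \<Rightarrow> nat" where
  "splice_snd n i k = (case glued_leg n i k of Inl a \<Rightarrow> 0 | Inr b \<Rightarrow> b)"

definition splice_orders :: "nat \<Rightarrow> nat \<Rightarrow> nat \<Rightarrow> (nat \<times> nat \<times> nat) set \<Rightarrow> (nat \<times> nat \<times> nat) set
    \<Rightarrow> (nat \<times> nat \<times> nat) set" where
  "splice_orders m n i R S =
    {(a, b, c). a \<le> m + n - 1 \<and> b \<le> m + n - 1 \<and> c \<le> m + n - 1 \<and>
      ((splice_fst n i a, splice_fst n i b, splice_fst n i c) \<in> R \<or>
       (splice_snd n i a, splice_snd n i b, splice_snd n i c) \<in> S)}"

text \<open>The unit is the only cyclic order on \<open>{0, 1}\<close>, which as a ternary relation is empty.\<close>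

definition uAs_c :: "(nat \<times> nat \<times> nat) set operad" where
  "uAs_c =
    \<lparr>Ops = (\<lambda>n. {R. cyclic_order_on {..n} R}),
     act = (\<lambda>n \<sigma> R. (\<lambda>(a, b, c). (\<sigma> a, \<sigma> b, \<sigma> c)) ` R),
     unt = {},
     pcomp = splice_orders\<rparr>"

lemma splice_inj:
  "splice_fst n i a = splice_fst n i b \<Longrightarrow> splice_snd n i a = splice_snd n i b \<Longrightarrow> a = b"
  by (auto simp: splice_fst_def splice_snd_def glued_leg_def split: if_splits)

lemma splice_disj: "splice_fst n i a = i \<longleftrightarrow> splice_snd n i a \<noteq> 0"
  by (auto simp: splice_fst_def splice_snd_def glued_leg_def split: if_splits)

lemma splice_fst_le: "a \<le> m + n - 1 \<Longrightarrow> 1 \<le> i \<Longrightarrow> i \<le> m \<Longrightarrow> splice_fst n i a \<le> m"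
  by (auto simp: splice_fst_def glued_leg_def split: if_splits)

lemma splice_snd_le: "a \<le> m + n - 1 \<Longrightarrow> 1 \<le> i \<Longrightarrow> i \<le> m \<Longrightarrow> splice_snd n i a \<le> n"
  by (auto simp: splice_snd_def glued_leg_def split: if_splits)

lemma cyclic_orderD:
  assumes "cyclic_order_on X R"
  shows "(a, b, c) \<in> R \<Longrightarrow> a \<in> X \<and> b \<in> X \<and> c \<in> X"
    and "(a, b, c) \<in> R \<Longrightarrow> (b, c, a) \<in> R"
    and "(a, b, c) \<in> R \<Longrightarrow> (c, b, a) \<notin> R"
    and "(a, b, c) \<in> R \<Longrightarrow> (a, c, d) \<in> R \<Longrightarrow> (a, b, d) \<in> R"
    and "a \<in> X \<Longrightarrow> b \<in> X \<Longrightarrow> c \<in> X \<Longrightarrow> a \<noteq> b \<Longrightarrow> b \<noteq> c \<Longrightarrow> a \<noteq> c \<Longrightarrow> (a, b, c) \<in> R \<or> (c, b, a) \<in> R"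
proof -
  note * = assms[unfolded cyclic_order_on_def]
  show "a \<in> X \<and> b \<in> X \<and> c \<in> X" if "(a, b, c) \<in> R" using *[THEN conjunct1] that by auto
  show "(b, c, a) \<in> R" if "(a, b, c) \<in> R"
    using *[THEN conjunct2, THEN conjunct1] that by blast
  show "(c, b, a) \<notin> R" if "(a, b, c) \<in> R"
    using *[THEN conjunct2, THEN conjunct2, THEN conjunct1] that by blast
  show "(a, b, d) \<in> R" if "(a, b, c) \<in> R" "(a, c, d) \<in> R"
    using *[THEN conjunct2, THEN conjunct2, THEN conjunct2, THEN conjunct1] that by blast
  show "(a, b, c) \<in> R \<or> (c, b, a) \<in> R"
    if "a \<in> X" "b \<in> X" "c \<in> X" "a \<noteq> b" "b \<noteq> c" "a \<noteq> c"
    using *[THEN conjunct2, THEN conjunct2, THEN conjunct2, THEN conjunct2] that by blast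
qed

lemma cyclic_order_distinct:
  assumes "cyclic_order_on X R" "(a, b, c) \<in> R"
  shows "a \<noteq> b" "b \<noteq> c" "a \<noteq> c"
  using cyclic_orderD(2)[OF assms] cyclic_orderD(2)[OF assms(1) cyclic_orderD(2)[OF assms]]
    cyclic_orderD(3)[OF assms] assms(2) cyclic_orderD(3)[OF assms(1) cyclic_orderD(2)[OF assms]]
    cyclic_orderD(3)[OF assms(1) cyclic_orderD(2)[OF assms(1) cyclic_orderD(2)[OF assms]]]
  by auto

lemma cyclic_order_splice:
  assumes R: "cyclic_order_on {..m} R" and S: "cyclic_order_on {..n} S" and i: "1 \<le> i" "i \<le> m"
  shows "cyclic_order_on {..m + n - 1} (splice_orders m n i R S)"
proof -
  let ?f = "splice_fst n i" and ?g = "splice_snd n i"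
  have d: "?f a = i \<and> ?g a \<noteq> 0 \<or> ?f a \<noteq> i \<and> ?g a = 0" for a
    using splice_disj[of n i a] by blast
  note Rd = cyclic_order_distinct[OF R] and Sd = cyclic_order_distinct[OF S]
  have excl: False if "(?f a, ?f b, ?f c) \<in> R" "(?g c, ?g b, ?g a) \<in> S" for a b c
    using Rd[OF that(1)] Sd[OF that(2)] d[of a] d[of b] d[of c] by (metis (no_types))
  have 1: "(a, b, c) \<in> splice_orders m n i R S \<Longrightarrow> (b, c, a) \<in> splice_orders m n i R S" for a b c
    unfolding splice_orders_def using cyclic_orderD(2)[OF R] cyclic_orderD(2)[OF S] by auto
  have 2: "(a, b, c) \<in> splice_orders m n i R S \<Longrightarrow> (c, b, a) \<notin> splice_orders m n i R S" for a b c
    unfolding splice_orders_def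
    using cyclic_orderD(3)[OF R] cyclic_orderD(3)[OF S] excl[of a b c] excl[of c b a] by auto
  have mixed1: "(?f a, ?f b, ?f e) \<in> R \<or> (?g a, ?g b, ?g e) \<in> S"
    if h: "(?f a, ?f b, ?f c) \<in> R" "(?g a, ?g c, ?g e) \<in> S" for a b c e
  proof -
    have "?g a = 0 \<or> ?g c = 0 \<Longrightarrow> ?g e \<noteq> 0" using Sd[OF h(2)] by auto
    moreover have "?f a \<noteq> i \<or> ?f c \<noteq> i" using Rd[OF h(1)] by auto
    ultimately have e: "?f e = i" using d by metis
    show ?thesis
    proof (cases "?f a = i")
      case True
      then have "?f b \<noteq> i" "?f c \<noteq> i" using Rd[OF h(1)] by auto
      then have "?g b = ?g c" using d by metis
      then show ?thesis using h(2) by simp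
    next
      case False
      then have "?g a = 0" using d by metis
      then have "?g c \<noteq> 0" using Sd[OF h(2)] by auto
      then have "?f c = i" using d by metis
      then show ?thesis using h(1) e by simp
    qed
  qed
  have mixed2: "(?f a, ?f b, ?f e) \<in> R \<or> (?g a, ?g b, ?g e) \<in> S"
    if h: "(?g a, ?g b, ?g c) \<in> S" "(?f a, ?f c, ?f e) \<in> R" for a b c e
  proof -
    have "?f a \<noteq> i \<or> ?f c \<noteq> i" using Rd[OF h(2)] by auto
    then have b: "?f b = i" using Sd[OF h(1)] d by metis
    show ?thesis
    proof (cases "?f a = i")
      case True
      then have "?f e \<noteq> i" "?f c \<noteq> i" using Rd[OF h(2)] by auto
      then have "?g e = ?g c" using d by metis
      then show ?thesis using h(1) by simp
    next
      case False
      then have "?g a = 0" using d by metis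
      then have "?g c \<noteq> 0" using Sd[OF h(1)] by auto
      then have "?f c = i" using d by metis
      then show ?thesis using h(2) b by simp
    qed
  qed
  have 3: "(a, b, e) \<in> splice_orders m n i R S"
    if "(a, b, c) \<in> splice_orders m n i R S" "(a, c, e) \<in> splice_orders m n i R S" for a b c e
    using that cyclic_orderD(4)[OF R, of "?f a" "?f b" "?f c" "?f e"]
      cyclic_orderD(4)[OF S, of "?g a" "?g b" "?g c" "?g e"] mixed1[of a b c e] mixed2[of a b c e]
    unfolding splice_orders_def mem_Collect_eq prod.case by blast
  have 4: "(a, b, c) \<in> splice_orders m n i R S \<or> (c, b, a) \<in> splice_orders m n i R S"
    if le: "a \<le> m + n - 1" "b \<le> m + n - 1" "c \<le> m + n - 1" and ne: "a \<noteq> b" "b \<noteq> c" "a \<noteq> c" for a b c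
  proof (cases "?f a \<noteq> ?f b \<and> ?f b \<noteq> ?f c \<and> ?f a \<noteq> ?f c")
    case True
    then show ?thesis unfolding splice_orders_def
      using le cyclic_orderD(5)[OF R, of "?f a" "?f b" "?f c"] splice_fst_le[OF _ i] by auto
  next
    case False
    have sep: "?g w \<noteq> ?g u" if "?f u = ?f v" "u \<noteq> v" "w \<noteq> u" for u v w
    proof
      assume eq: "?g w = ?g u"
      have "?g u \<noteq> 0"
      proof
        assume "?g u = 0"
        then have "?g v = 0" using d[of u] d[of v] that(1) by simp
        then show False using splice_inj[OF that(1)] \<open>?g u = 0\<close> that(2) by simp
      qed
      then have "?f w = ?f u" using d[of u] d[of w] eq by simp
      then show False using splice_inj[OF _ eq] that(3) by simp
    qed
    consider "?f a = ?f b" | "?f b = ?f c" | "?f a = ?f c" using False by blast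
    then have "?g a \<noteq> ?g b \<and> ?g b \<noteq> ?g c \<and> ?g a \<noteq> ?g c"
    proof cases
      case 1
      then show ?thesis
        using sep[of a b b] sep[of a b c] sep[of b a c] ne by auto
    next
      case 2
      then show ?thesis
        using sep[of b c a] sep[of c b a] sep[of c b b] ne by auto
    next
      case 3
      then show ?thesis
        using sep[of a c b] sep[of c a b] sep[of c a a] ne by auto
    qed
    then show ?thesis unfolding splice_orders_def
      using le cyclic_orderD(5)[OF S, of "?g a" "?g b" "?g c"] splice_snd_le[OF _ i] by auto
  qed
  show ?thesis unfolding cyclic_order_on_def
  proof (intro conjI allI impI ballI)
    show "splice_orders m n i R S \<subseteq> {..m + n - 1} \<times> {..m + n - 1} \<times> {..m + n - 1}"
      by (auto simp: splice_orders_def)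
  qed (fact 1 | fact 2 | (elim conjE, erule (1) 3) | (elim conjE, erule 4, assumption+) | (elim conjE, rule 4; simp))+
qed

lemma act_uAs_c_iff:
  assumes "\<sigma> permutes {..n}"
  shows "(\<sigma> a, \<sigma> b, \<sigma> c) \<in> act uAs_c m \<sigma> R \<longleftrightarrow> (a, b, c) \<in> R"
proof
  assume "(\<sigma> a, \<sigma> b, \<sigma> c) \<in> act uAs_c m \<sigma> R"
  then obtain x y z where "(x, y, z) \<in> R" "\<sigma> a = \<sigma> x" "\<sigma> b = \<sigma> y" "\<sigma> c = \<sigma> z"
    by (auto simp: uAs_c_def)
  then show "(a, b, c) \<in> R" using injD[OF permutes_inj[OF assms]] by metis
next
  assume "(a, b, c) \<in> R"
  then have "(\<lambda>(a, b, c). (\<sigma> a, \<sigma> b, \<sigma> c)) (a, b, c) \<in> act uAs_c m \<sigma> R"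
    unfolding uAs_c_def by (simp only: operad.simps) (rule imageI)
  then show "(\<sigma> a, \<sigma> b, \<sigma> c) \<in> act uAs_c m \<sigma> R" by simp
qed

lemma permutes_triple:
  assumes "\<sigma> permutes S" obtains a' b' c' where "a = \<sigma> a'" "b = \<sigma> b'" "c = \<sigma> c'"
  using permutes_surj[OF assms] by (metis surjD)

lemma cyclic_order_act:
  assumes \<sigma>: "\<sigma> permutes {..n}" and R: "cyclic_order_on {..n} R"
  shows "cyclic_order_on {..n} (act uAs_c n \<sigma> R)"
proof -
  note iff = act_uAs_c_iff[OF \<sigma>]
  have mem: "\<sigma> a \<in> {..n} \<longleftrightarrow> a \<in> {..n}" for a using permutes_in_image[OF \<sigma>] by blast
  let ?A = "act uAs_c n \<sigma> R"
  have 0: "a \<in> {..n} \<and> b \<in> {..n} \<and> c \<in> {..n}" if "(a, b, c) \<in> ?A" for a b c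
    using that cyclic_orderD(1)[OF R] mem by (auto simp: uAs_c_def)
  have 1: "(b, c, a) \<in> ?A" if "(a, b, c) \<in> ?A" for a b c
    by (rule permutes_triple[OF \<sigma>, of a b c]) (use that cyclic_orderD(2)[OF R] iff in blast)
  have 2: "(c, b, a) \<notin> ?A" if "(a, b, c) \<in> ?A" for a b c
    by (rule permutes_triple[OF \<sigma>, of a b c]) (use that cyclic_orderD(3)[OF R] iff in blast)
  have 3: "(a, b, d) \<in> ?A" if "(a, b, c) \<in> ?A" "(a, c, d) \<in> ?A" for a b c d
    by (rule permutes_triple[OF \<sigma>, of a b c], rule permutes_triple[OF \<sigma>, of d d d])
      (use that cyclic_orderD(4)[OF R] iff in blast)
  have 4: "(a, b, c) \<in> ?A \<or> (c, b, a) \<in> ?A"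
    if le: "a \<in> {..n}" "b \<in> {..n}" "c \<in> {..n}" and ne: "a \<noteq> b" "b \<noteq> c" "a \<noteq> c" for a b c
  proof (rule permutes_triple[OF \<sigma>, of a b c])
    fix a' b' c' assume *: "a = \<sigma> a'" "b = \<sigma> b'" "c = \<sigma> c'"
    show ?thesis using cyclic_orderD(5)[OF R, of a' b' c'] le ne unfolding * iff mem by blast
  qed
  show ?thesis unfolding cyclic_order_on_def
  proof (intro conjI allI impI ballI)
    show "?A \<subseteq> {..n} \<times> {..n} \<times> {..n}" using 0 by (auto simp del: atMost_iff)
  qed (fact 1 | fact 2 | (elim conjE, erule (1) 3) | (elim conjE, erule 4, assumption+) | (elim conjE, rule 4; simp))+
qed

lemma splice_fst_eq: "splice_fst n i k = (if k < i then k else if k < i + n then i else k + 1 - n)"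
  and splice_snd_eq: "splice_snd n i k = (if i \<le> k \<and> k < i + n then k - i + 1 else 0)"
  by (simp_all add: splice_fst_def splice_snd_def glued_leg_def)

lemma splice_sequential_maps:
  assumes "1 \<le> i" "1 \<le> j" "j \<le> n"
  shows "splice_fst n i (splice_fst l (i + j - 1) k) = splice_fst (n + l - 1) i k"
    and "splice_snd n i (splice_fst l (i + j - 1) k) = splice_fst l j (splice_snd (n + l - 1) i k)"
    and "splice_snd l (i + j - 1) k = splice_snd l j (splice_snd (n + l - 1) i k)"
proof -
  obtain j' d where j: "j = Suc j'" and n: "n = Suc (j' + d)"
    using assms by (metis Suc_le_D Suc_le_mono le_iff_add One_nat_def)
  consider "k < i" | x where "k = i + x" "x < j'" | x where "k = i + j' + x" "x < l"
    | x where "k = i + j' + l + x" "x < d" | x where "k = i + j' + l + d + x"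
    by (metis le_iff_add linorder_not_less nat_add_left_cancel_less)
  note cs = this
  show "splice_fst n i (splice_fst l (i + j - 1) k) = splice_fst (n + l - 1) i k"
    using cs by cases (simp_all add: splice_fst_eq j n)
  show "splice_snd n i (splice_fst l (i + j - 1) k) = splice_fst l j (splice_snd (n + l - 1) i k)"
    using cs by cases (simp_all add: splice_fst_eq splice_snd_eq j n)
  show "splice_snd l (i + j - 1) k = splice_snd l j (splice_snd (n + l - 1) i k)"
    using cs by cases (simp_all add: splice_snd_eq j n)
qed

lemma splice_parallel_maps:
  assumes "1 \<le> i" "i < j"
  shows "splice_fst n i (splice_fst l (j + n - 1) k) = splice_fst l j (splice_fst n i k)"
    and "splice_snd n i (splice_fst l (j + n - 1) k) = splice_snd n i k"
    and "splice_snd l (j + n - 1) k = splice_snd l j (splice_fst n i k)"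
proof -
  obtain d where j: "j = Suc (i + d)" using less_imp_Suc_add[OF assms(2)] by auto
  consider "k < i" | x where "k = i + x" "x < n" | x where "k = i + n + x" "x < d"
    | x where "k = i + n + d + x" "x < l" | x where "k = i + n + d + l + x"
    by (metis le_iff_add linorder_not_less nat_add_left_cancel_less)
  note cs = this
  show "splice_fst n i (splice_fst l (j + n - 1) k) = splice_fst l j (splice_fst n i k)"
    using cs assms(1) by cases (simp_all add: splice_fst_eq j)
  show "splice_snd n i (splice_fst l (j + n - 1) k) = splice_snd n i k"
    using cs assms(1) by cases (simp_all add: splice_fst_eq splice_snd_eq j)
  show "splice_snd l (j + n - 1) k = splice_snd l j (splice_fst n i k)"
    using cs assms(1) by cases (simp_all add: splice_fst_eq splice_snd_eq j)
qed

lemma splice_act: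
  assumes \<rho>: "\<rho> permutes {..m + n - 1}"
    and maps: "\<And>k. k \<le> m + n - 1 \<Longrightarrow> splice_fst n' i' (\<rho> k) = \<sigma>' (f k) \<and> splice_snd n' i' (\<rho> k) = \<tau>' (g k)"
    and mn: "m' + n' - 1 = m + n - 1"
    and RS: "\<And>a b c. a \<le> m + n - 1 \<Longrightarrow> b \<le> m + n - 1 \<Longrightarrow> c \<le> m + n - 1 \<Longrightarrow>
      (\<sigma>' (f a), \<sigma>' (f b), \<sigma>' (f c)) \<in> R' \<or> (\<tau>' (g a), \<tau>' (g b), \<tau>' (g c)) \<in> S' \<longleftrightarrow>
      (splice_fst n i a, splice_fst n i b, splice_fst n i c) \<in> R \<or>
      (splice_snd n i a, splice_snd n i b, splice_snd n i c) \<in> S"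
  shows "act uAs_c (m + n - 1) \<rho> (splice_orders m n i R S) = splice_orders m' n' i' R' S'"
proof -
  have "(a, b, c) \<in> act uAs_c (m + n - 1) \<rho> (splice_orders m n i R S) \<longleftrightarrow>
      (a, b, c) \<in> splice_orders m' n' i' R' S'" for a b c
  proof (rule permutes_triple[OF \<rho>, of a b c])
    fix a' b' c' assume *: "a = \<rho> a'" "b = \<rho> b'" "c = \<rho> c'"
    have mem: "\<rho> k \<le> m + n - 1 \<longleftrightarrow> k \<le> m + n - 1" for k using permutes_in_image[OF \<rho>, of k] by simp
    show ?thesis
      unfolding * act_uAs_c_iff[OF \<rho>]
      unfolding splice_orders_def mem_Collect_eq prod.case mn mem
      by (simp add: maps RS del: One_nat_def cong: conj_cong)
  qed
  then show ?thesis by auto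
qed

theorem uAs_c_cyclic_operad: "cyclic_operad uAs_c"
proof
  note [simp] = uAs_c_def
  fix m n l i j k :: nat and p q r :: "(nat \<times> nat \<times> nat) set" and \<sigma> \<tau> \<rho> :: "nat \<Rightarrow> nat"
  show "act uAs_c n \<sigma> p \<in> Ops uAs_c n" if "p \<in> Ops uAs_c n" "\<sigma> permutes {..n}"
    using that cyclic_order_act[of \<sigma> n p] by simp
  show "act uAs_c n id p = p" by (simp add: case_prod_unfold)
  show "act uAs_c n (\<sigma> \<circ> \<tau>) p = act uAs_c n \<sigma> (act uAs_c n \<tau> p)"
    by (simp add: case_prod_unfold image_image)
  show "unt uAs_c \<in> Ops uAs_c 1" by (auto simp: cyclic_order_on_def)
  show "act uAs_c 1 \<sigma> (unt uAs_c) = unt uAs_c" by simp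
  show "pcomp uAs_c m n i p q \<in> Ops uAs_c (m + n - 1)"
    if "p \<in> Ops uAs_c m" "q \<in> Ops uAs_c n" "1 \<le> i" "i \<le> m"
    using that cyclic_order_splice[of m p n q i] by simp
  show "pcomp uAs_c 1 n 1 (unt uAs_c) p = p" if "p \<in> Ops uAs_c n"
  proof -
    have "splice_snd n 1 k = k" if "k \<le> n" for k
      using that by (auto simp: splice_snd_def glued_leg_def)
    then show ?thesis using that cyclic_orderD(1)[of "{..n}" p]
      by (auto simp: splice_orders_def)
  qed
  show "pcomp uAs_c m 1 i p (unt uAs_c) = p" if "p \<in> Ops uAs_c m"
  proof -
    have "splice_fst 1 i k = k" for k by (auto simp: splice_fst_def glued_leg_def)
    then show ?thesis using that cyclic_orderD(1)[of "{..m}" p]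
      by (auto simp: splice_orders_def)
  qed
  show "pcomp uAs_c (m + n - 1) l (i + j - 1) (pcomp uAs_c m n i p q) r
      = pcomp uAs_c m (n + l - 1) i p (pcomp uAs_c n l j q r)"
    if "1 \<le> i" "i \<le> m" "1 \<le> j" "j \<le> n"
  proof -
    have M: "m + (n + l - 1) - 1 = m + n - 1 + l - 1" using that by simp
    have a: "splice_fst l (i + j - 1) k \<le> m + n - 1" if "k \<le> m + n - 1 + l - 1" for k
      using that \<open>1 \<le> i\<close> \<open>i \<le> m\<close> \<open>1 \<le> j\<close> \<open>j \<le> n\<close> by (intro splice_fst_le) auto
    have b: "splice_snd (n + l - 1) i k \<le> n + l - 1" if "k \<le> m + n - 1 + l - 1" for k
      using that \<open>1 \<le> i\<close> \<open>i \<le> m\<close> \<open>1 \<le> j\<close> \<open>j \<le> n\<close> by (intro splice_snd_le[of _ m]) auto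
    show ?thesis
      unfolding uAs_c_def operad.simps splice_orders_def M
      by (rule Collect_cong) (auto simp only: prod.case splice_sequential_maps[OF that(1,3,4)] a b mem_Collect_eq)
  qed
  show "pcomp uAs_c (m + n - 1) l (k + n - 1) (pcomp uAs_c m n i p q) r
      = pcomp uAs_c (m + l - 1) n i (pcomp uAs_c m l k p r) q"
    if "1 \<le> i" "i < k" "k \<le> m"
  proof -
    have M: "m + l - 1 + n - 1 = m + n - 1 + l - 1" using that by simp
    have a: "splice_fst l (k + n - 1) x \<le> m + n - 1" if "x \<le> m + n - 1 + l - 1" for x
      using that \<open>1 \<le> i\<close> \<open>i < k\<close> \<open>k \<le> m\<close> by (intro splice_fst_le) auto
    have b: "splice_fst n i x \<le> m + l - 1" if "x \<le> m + n - 1 + l - 1" for x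
      using that \<open>1 \<le> i\<close> \<open>i < k\<close> \<open>k \<le> m\<close> by (intro splice_fst_le) auto
    show ?thesis
      unfolding uAs_c_def operad.simps splice_orders_def M
      by (rule Collect_cong) (auto simp only: prod.case splice_parallel_maps[OF that(1,2)] a b mem_Collect_eq)
  qed
  show "act uAs_c (m + n - 1) \<rho> (pcomp uAs_c m n i p q)
      = pcomp uAs_c m n (\<sigma> i) (act uAs_c m \<sigma> p) (act uAs_c n \<tau> q)"
    if \<sigma>: "\<sigma> permutes {..m}" and \<tau>: "\<tau> permutes {..n}" and \<rho>: "\<rho> permutes {..m + n - 1}" and "\<tau> 0 = 0"
      and legs: "\<forall>k\<le>m + n - 1. glued_leg n (\<sigma> i) (\<rho> k) = map_sum \<sigma> \<tau> (glued_leg n i k)"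
  proof -
    have "splice_fst n (\<sigma> i) (\<rho> k) = \<sigma> (splice_fst n i k) \<and>
        splice_snd n (\<sigma> i) (\<rho> k) = \<tau> (splice_snd n i k)" if "k \<le> m + n - 1" for k
      using legs that \<open>\<tau> 0 = 0\<close> by (auto simp: splice_fst_def splice_snd_def split: sum.splits)
    then have "act uAs_c (m + n - 1) \<rho> (splice_orders m n i p q)
        = splice_orders m n (\<sigma> i) (act uAs_c m \<sigma> p) (act uAs_c n \<tau> q)"
      by (rule splice_act[OF \<rho>]) (simp_all only: act_uAs_c_iff[OF \<sigma>] act_uAs_c_iff[OF \<tau>])
    then show ?thesis by simp
  qed
  show "act uAs_c (m + n - 1) \<rho> (pcomp uAs_c m n i p q)
      = pcomp uAs_c n m (\<tau> 0) (act uAs_c n \<tau> q) (act uAs_c m \<sigma> p)"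
    if \<sigma>: "\<sigma> permutes {..m}" and \<tau>: "\<tau> permutes {..n}" and \<rho>: "\<rho> permutes {..m + n - 1}" and "\<sigma> i = 0"
      and legs: "\<forall>k\<le>m + n - 1. glued_leg m (\<tau> 0) (\<rho> k)
        = (case glued_leg n i k of Inl a \<Rightarrow> Inr (\<sigma> a) | Inr b \<Rightarrow> Inl (\<tau> b))"
  proof -
    have "splice_fst m (\<tau> 0) (\<rho> k) = \<tau> (splice_snd n i k) \<and>
        splice_snd m (\<tau> 0) (\<rho> k) = \<sigma> (splice_fst n i k)" if "k \<le> m + n - 1" for k
      using legs that \<open>\<sigma> i = 0\<close> by (auto simp: splice_fst_def splice_snd_def split: sum.splits)
    then have "act uAs_c (m + n - 1) \<rho> (splice_orders m n i p q)
        = splice_orders n m (\<tau> 0) (act uAs_c n \<tau> q) (act uAs_c m \<sigma> p)"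
      by (rule splice_act[OF \<rho>])
        (auto simp only: act_uAs_c_iff[OF \<sigma>] act_uAs_c_iff[OF \<tau>] add.commute)
    then show ?thesis by simp
  qed
qed


section \<open>Connes' cyclic category\<close>

text \<open>Objects are the \<open>[n]\<close>, \<open>n \<ge> 0\<close>.  Morphisms \<open>[m] \<rightarrow> [n]\<close> are the monotone maps \<open>f\<close> from \<open>\<int>\<close> to \<open>\<int>\<close>
  with \<open>f (x + (m + 1)) = f x + (n + 1)\<close>, modulo addition of multiples of \<open>n + 1\<close>; equivalently, the
  homotopy classes of monotone degree one maps of the circle to itself carrying the
  \<open>(m + 1)\<close>-st roots of unity to the \<open>(n + 1)\<close>-st ones.\<close>

definition shift_class :: "nat \<Rightarrow> (int \<Rightarrow> int) \<Rightarrow> (int \<Rightarrow> int) set" where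
  "shift_class n f = {\<lambda>x. f x + k * (int n + 1) | k. True}"

definition Lambda_cat :: "(nat, (int \<Rightarrow> int) set) cat" where
  "Lambda_cat =
    \<lparr>Obj = UNIV,
     Hom = (\<lambda>m n. {shift_class n f | f. mono f \<and> (\<forall>x. f (x + (int m + 1)) = f x + (int n + 1))}),
     Ident = (\<lambda>n. shift_class n id),
     Comp = (\<lambda>G F. {g \<circ> f | g f. g \<in> G \<and> f \<in> F})\<rparr>"

end

theory Submission
  imports Defs
begin

text \<open>A cyclic order on a finite set is the same as a word in its elements without repetitions, up to
rotation, and gluing a leg \<open>a\<close> of one element of \<open>uAs_c\<close> to a leg \<open>a\<close> of another one amounts to
replacing \<open>a\<close> in a word of the first one by the rest of a word of the second one that begins with
\<open>a\<close> (\<open>carries_glue\<close>).  Therefore a morphism \<open>p \<rightarrow> t\<close> of the twisted arrow category is determined by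
its blocks: for every leg \<open>j\<close> of \<open>p\<close> the word in which the legs of \<open>t\<close> that come from \<open>q\<^sub>j\<close> follow
each other in \<open>q\<^sub>j\<close> after leg \<open>0\<close>.  Conversely, every family of words without repetitions comes
from exactly one tuple \<open>(q; lam)\<close> (\<open>block_std_mor\<close>, \<open>std_mor_blocks\<close>).  Concatenating the blocks
along a word of \<open>p\<close> gives a word of \<open>t\<close> (\<open>tw_target_blocks\<close>), and the blocks of a composite are
concatenations of blocks (\<open>tw_comp_std_mor\<close>).

Now write the cyclic words of \<open>p\<close> and \<open>t\<close> as periodic words indexed by \<open>\<int>\<close>.  The blocks of a morphism
cut the periodic word of \<open>t\<close> into consecutive arcs, one for each position \<open>y\<close> of the periodic word
of \<open>p\<close>.  If \<open>g y\<close> is the place where the arc of \<open>y\<close> begins, then \<open>g\<close> is monotone,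
\<open>g (y + (m + 1)) = g y + (n + 1)\<close> for \<open>p\<close>, \<open>t\<close> of arities \<open>m\<close>, \<open>n\<close>, and \<open>g\<close> is unique up to adding
multiples of \<open>n + 1\<close>, since a position in the periodic word is known up to the period
from its letter.  So \<open>g\<close> represents a morphism of Connes' category (\<open>ex_tracks\<close>,
\<open>tracks_unique_lift\<close>).  Every such \<open>g\<close> arises from exactly one morphism (\<open>ex_tracked\<close>,
\<open>tracks_inject\<close>), and composition of morphisms corresponds to composition of the maps of \<open>\<int>\<close>
(\<open>tracks_comp\<close>).  Sending an object to its arity is thus a fully faithful functor that is surjective
on objects.

On the legs a morphism \<open>p \<rightarrow> t\<close> induces a map in the opposite direction, from the legs of \<open>t\<close>
to those of \<open>p\<close>.  Recording where the fibres begin, instead of this map, turns it around: this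
is the self-duality of the cyclic category, and the functor to it is covariant.\<close>

section \<open>Cyclic orders as words up to rotation\<close>

definition ccw :: "nat \<Rightarrow> nat \<Rightarrow> nat \<Rightarrow> bool" where
  "ccw i j k \<longleftrightarrow> i < j \<and> j < k \<or> j < k \<and> k < i \<or> k < i \<and> i < j"

definition cyc :: "'a list \<Rightarrow> ('a \<times> 'a \<times> 'a) set" where
  "cyc w = {(w ! i, w ! j, w ! k) | i j k.
    i < length w \<and> j < length w \<and> k < length w \<and> ccw i j k}"

lemma cyc_nth_iff:
  assumes "distinct w" "i < length w" "j < length w" "k < length w"
  shows "(w ! i, w ! j, w ! k) \<in> cyc w \<longleftrightarrow> ccw i j k"
  using assms by (auto simp: cyc_def nth_eq_iff_index_eq)

lemma cycE:
  assumes "(x, y, z) \<in> cyc w"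
  obtains i j k where "x = w ! i" "y = w ! j" "z = w ! k" "i < length w" "j < length w"
    "k < length w" "ccw i j k"
  using assms by (auto simp: cyc_def)

lemma cyc_in_set: "(x, y, z) \<in> cyc w \<Longrightarrow> x \<in> set w \<and> y \<in> set w \<and> z \<in> set w"
  by (auto elim!: cycE)

lemma cyc_map: "cyc (map f w) = (\<lambda>(x, y, z). (f x, f y, f z)) ` cyc w"
proof -
  have "(f (w ! i), f (w ! j), f (w ! k)) \<in> (\<lambda>(x, y, z). (f x, f y, f z)) ` cyc w"
    if "i < length w" "j < length w" "k < length w" "ccw i j k" for i j k
    by (rule image_eqI[of _ _ "(w ! i, w ! j, w ! k)"]) (use that in \<open>auto simp: cyc_def\<close>)
  moreover have "(f x, f y, f z) \<in> cyc (map f w)" if "(x, y, z) \<in> cyc w" for x y z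
    using that by (elim cycE) (auto simp: cyc_def, metis nth_map)
  ultimately show ?thesis by (auto simp: cyc_def[of "map f w"])
qed

lemma cyc_map_iff:
  assumes "inj_on f (set w)" "x \<in> set w" "y \<in> set w" "z \<in> set w"
  shows "(f x, f y, f z) \<in> cyc (map f w) \<longleftrightarrow> (x, y, z) \<in> cyc w"
proof
  assume "(f x, f y, f z) \<in> cyc (map f w)"
  then obtain x' y' z' where "(x', y', z') \<in> cyc w" "f x = f x'" "f y = f y'" "f z = f z'"
    unfolding cyc_map by auto
  then show "(x, y, z) \<in> cyc w" using cyc_in_set[of x' y' z' w] assms by (metis inj_onD)
next
  assume "(x, y, z) \<in> cyc w"
  then show "(f x, f y, f z) \<in> cyc (map f w)"
    unfolding cyc_map by (intro image_eqI[of _ _ "(x, y, z)"]) auto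
qed

lemma cyclic_order_cyc:
  assumes w: "distinct w"
  shows "cyclic_order_on (set w) (cyc w)"
proof -
  have 0: "cyc w \<subseteq> set w \<times> set w \<times> set w" by (auto dest: cyc_in_set)
  have 1: "(y, z, x) \<in> cyc w" if "(x, y, z) \<in> cyc w" for x y z
    using that by (elim cycE) (auto simp: cyc_nth_iff[OF w] ccw_def)
  have 2: "(z, y, x) \<notin> cyc w" if "(x, y, z) \<in> cyc w" for x y z
    using that by (elim cycE) (auto simp: cyc_nth_iff[OF w] ccw_def)
  have 3: "(x, y, u) \<in> cyc w" if "(x, y, z) \<in> cyc w" "(x, z, u) \<in> cyc w" for x y z u
  proof -
    from that(2) have "u \<in> set w" using cyc_in_set by fast
    then obtain l where l: "l < length w" "u = w ! l" by (metis in_set_conv_nth)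
    show ?thesis using that l
      by (elim cycE[of x y z]) (auto simp: cyc_nth_iff[OF w] ccw_def)
  qed
  have 4: "(x, y, z) \<in> cyc w \<or> (z, y, x) \<in> cyc w"
    if "x \<in> set w" "y \<in> set w" "z \<in> set w" "x \<noteq> y \<and> y \<noteq> z \<and> x \<noteq> z" for x y z
  proof -
    from that obtain i j k where *: "i < length w" "x = w ! i" "j < length w" "y = w ! j"
      "k < length w" "z = w ! k" by (metis in_set_conv_nth)
    then have "i \<noteq> j \<and> j \<noteq> k \<and> i \<noteq> k" using that(4) by auto
    then show ?thesis using * by (auto simp: cyc_nth_iff[OF w] ccw_def)
  qed
  show ?thesis unfolding cyclic_order_on_def
  proof (intro conjI allI impI ballI)
    show "cyc w \<subseteq> set w \<times> set w \<times> set w" by (rule 0)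
  qed (fact 1 | fact 2 | (elim conjE, erule (1) 3) | (erule (3) 4))+
qed

lemma cyc_rotate1:
  assumes "distinct w"
  shows "cyc (rotate1 w) = cyc w"
proof (cases w)
  case (Cons a v)
  have d: "distinct (a # v)" "distinct (v @ [a])" using assms Cons by auto
  let ?n = "length v"
  have e: "(a # v) ! i = (v @ [a]) ! (if i = 0 then ?n else i - 1)" if "i \<le> ?n" for i
    using that by (auto simp: nth_append nth_Cons')
  have e': "(v @ [a]) ! i = (a # v) ! (if i = ?n then 0 else i + 1)" if "i \<le> ?n" for i
    using that by (auto simp: nth_append)
  have 1: "(x, y, z) \<in> cyc (v @ [a])" if "(x, y, z) \<in> cyc (a # v)" for x y z
  proof -
    from that obtain i j k where *: "x = (a # v) ! i" "y = (a # v) ! j" "z = (a # v) ! k"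
      "i \<le> ?n" "j \<le> ?n" "k \<le> ?n" "ccw i j k" by (auto elim!: cycE)
    show ?thesis unfolding *(1-3) e[OF *(4)] e[OF *(5)] e[OF *(6)]
      by (subst cyc_nth_iff[OF d(2)]) (use *(4-7) in \<open>auto simp: ccw_def\<close>)
  qed
  have 2: "(x, y, z) \<in> cyc (a # v)" if "(x, y, z) \<in> cyc (v @ [a])" for x y z
  proof -
    from that obtain i j k where *: "x = (v @ [a]) ! i" "y = (v @ [a]) ! j" "z = (v @ [a]) ! k"
      "i \<le> ?n" "j \<le> ?n" "k \<le> ?n" "ccw i j k" by (auto elim!: cycE)
    show ?thesis unfolding *(1-3) e'[OF *(4)] e'[OF *(5)] e'[OF *(6)]
      by (subst cyc_nth_iff[OF d(1)]) (use *(4-7) in \<open>auto simp: ccw_def\<close>)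
  qed
  show ?thesis unfolding Cons using 1 2 by auto
qed simp

lemma cyc_rotate: "distinct w \<Longrightarrow> cyc (rotate s w) = cyc w"
  by (induction s) (simp_all add: cyc_rotate1)

lemma cyc_append_commute:
  assumes "distinct (v @ w)"
  shows "cyc (w @ v) = cyc (v @ w)"
  using cyc_rotate[OF assms, of "length v"] by (simp add: rotate_append)

text \<open>Cutting at the place \<open>l\<close>: three places are in cyclic order iff they are so after collapsing all
  places from \<open>l\<close> on to one, or after collapsing all places before \<open>l\<close> to one.  For places of \<open>v @ w\<close> and
  \<open>l = length v\<close>, the collapsed places belong to \<open>v @ [a]\<close> and \<open>a # w\<close>.\<close>

lemma ccw_splice:
  "ccw i j k \<longleftrightarrow> ccw (min i l) (min j l) (min k l) \<or> ccw (i + 1 - l) (j + 1 - l) (k + 1 - l)"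
proof -
  have *: "x < l \<or> (\<exists>x'. x = l + x')" for x by (metis le_iff_add linorder_not_less)
  show ?thesis using *[of i] *[of j] *[of k] by (elim disjE exE; simp add: ccw_def; linarith?)
qed

text \<open>The splicing rule of \<open>splice_orders\<close> in terms of words: \<open>v @ [a]\<close> is the view of \<open>v @ w\<close> in which
  all of \<open>w\<close> is at the leg \<open>a\<close>, and \<open>a # w\<close> the one in which all of \<open>v\<close> is there.\<close>

lemma cyc_append_iff:
  assumes d: "distinct (v @ w)" and a: "a \<notin> set v" "a \<notin> set w"
    and xyz: "x \<in> set (v @ w)" "y \<in> set (v @ w)" "z \<in> set (v @ w)"
  defines "f \<equiv> \<lambda>x. if x \<in> set v then x else a" and "g \<equiv> \<lambda>x. if x \<in> set v then a else x"
  shows "(x, y, z) \<in> cyc (v @ w) \<longleftrightarrow> (f x, f y, f z) \<in> cyc (v @ [a]) \<or> (g x, g y, g z) \<in> cyc (a # w)"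
proof -
  let ?l = "length v"
  have dv: "distinct (v @ [a])" and dw: "distinct (a # w)" using d a by auto
  have mem: "(v @ w) ! i \<in> set v \<longleftrightarrow> i < ?l" if "i < length (v @ w)" for i
  proof (cases "i < ?l")
    case False
    then have "(v @ w) ! i \<in> set w" using that by (auto simp: nth_append)
    then show ?thesis using False d by auto
  qed (auto simp: nth_append)
  have f: "f ((v @ w) ! i) = (v @ [a]) ! min i ?l" if "i < length (v @ w)" for i
    using mem[OF that] by (auto simp: f_def nth_append min_def)
  have g: "g ((v @ w) ! i) = (a # w) ! (i + 1 - ?l)" if "i < length (v @ w)" for i
    using mem[OF that] by (auto simp: g_def nth_append Suc_diff_le)
  obtain i j k where *: "x = (v @ w) ! i" "y = (v @ w) ! j" "z = (v @ w) ! k"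
    and le: "i < length (v @ w)" "j < length (v @ w)" "k < length (v @ w)"
    using xyz by (metis in_set_conv_nth)
  have "(x, y, z) \<in> cyc (v @ w) \<longleftrightarrow> ccw i j k" unfolding * by (rule cyc_nth_iff[OF d le])
  moreover have "(f x, f y, f z) \<in> cyc (v @ [a]) \<longleftrightarrow> ccw (min i ?l) (min j ?l) (min k ?l)"
    unfolding * f[OF le(1)] f[OF le(2)] f[OF le(3)] by (rule cyc_nth_iff[OF dv]) auto
  moreover have "(g x, g y, g z) \<in> cyc (a # w) \<longleftrightarrow> ccw (i + 1 - ?l) (j + 1 - ?l) (k + 1 - ?l)"
    unfolding * g[OF le(1)] g[OF le(2)] g[OF le(3)] by (rule cyc_nth_iff[OF dw]) (use le in auto)
  ultimately show ?thesis using ccw_splice[of i j k ?l] by simp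
qed

lemma ex_sorted_wrt:
  assumes "finite X"
    and "\<And>x y z. x \<in> X \<Longrightarrow> y \<in> X \<Longrightarrow> z \<in> X \<Longrightarrow> r x y \<Longrightarrow> r y z \<Longrightarrow> r x z"
    and "\<And>x y. x \<in> X \<Longrightarrow> y \<in> X \<Longrightarrow> x \<noteq> y \<Longrightarrow> r x y \<or> r y x"
  shows "\<exists>v. distinct v \<and> set v = X \<and> sorted_wrt r v"
  using assms
proof (induction X rule: finite_induct)
  case (insert a X)
  have "\<exists>v. distinct v \<and> set v = X \<and> sorted_wrt r v"
    by (rule insert.IH) (rule insert.prems; simp)+
  then obtain v where v: "distinct v" "set v = X" "sorted_wrt r v" by blast
  have ge: "r a x" if "x \<in> X" "\<not> r x a" for x
    using insert.prems(2)[of a x] insert.hyps(2) that by (metis insertCI)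
  have le: "r x y" if "x \<in> X" "y \<in> X" "r x a" "\<not> r y a" for x y
    using that insert.prems(1)[of x a y] ge[of y] by simp
  let ?w = "filter (\<lambda>x. r x a) v @ a # filter (\<lambda>x. \<not> r x a) v"
  have "sorted_wrt r ?w"
    using v ge le by (auto simp: sorted_wrt_append sorted_wrt_filter)
  then show ?case using v insert.hyps(2)
    by (intro exI[of _ ?w]) auto
qed auto

lemma sorted_wrt_unique:
  assumes "\<And>x y. r x y \<Longrightarrow> \<not> r y x"
  shows "sorted_wrt r v \<Longrightarrow> sorted_wrt r w \<Longrightarrow> set v = set w \<Longrightarrow> v = w"
proof (induction v arbitrary: w)
  case (Cons a v)
  then obtain b u where w: "w = b # u" by (cases w) auto
  have ir: "\<not> r x x" for x using assms by blast
  have "a = b"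
  proof (rule ccontr)
    assume "a \<noteq> b"
    moreover have "a \<in> set (b # u)" "b \<in> set (a # v)" using Cons.prems(3) unfolding w by auto
    ultimately have "r a b" "r b a" using Cons.prems(1,2) unfolding w by auto
    then show False using assms by blast
  qed
  moreover have "a \<notin> set v" "b \<notin> set u" using Cons.prems ir unfolding w by auto
  ultimately have "set v = set u" using Cons.prems(3) unfolding w by auto
  then show ?case using Cons.IH[of u] Cons.prems \<open>a = b\<close> unfolding w by auto
qed simp

lemma sorted_wrt_cyc: "distinct (a # v) \<Longrightarrow> sorted_wrt (\<lambda>x y. (a, x, y) \<in> cyc (a # v)) v"
  unfolding sorted_wrt_iff_nth_less
proof (intro allI impI)
  fix i j assume "distinct (a # v)" "i < j" "j < length v"
  then show "(a, v ! i, v ! j) \<in> cyc (a # v)"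
    using cyc_nth_iff[of "a # v" 0 "Suc i" "Suc j"] by (simp add: ccw_def)
qed

text \<open>Fixing the first letter removes the ambiguity by rotations, because \<open>(a, x, y)\<close> being in cyclic
  order is then a linear order in \<open>x\<close> and \<open>y\<close>, along which the rest of the word is sorted.\<close>

lemma cyc_inject:
  assumes "distinct (a # v)" "distinct (a # w)" "set v = set w" "cyc (a # v) = cyc (a # w)"
  shows "v = w"
proof (rule sorted_wrt_unique)
  let ?r = "\<lambda>x y. (a, x, y) \<in> cyc (a # v)"
  show "\<not> ?r y x" if "?r x y" for x y
  proof
    assume "?r y x"
    then have "(y, x, a) \<in> cyc (a # v)"
      using cyclic_orderD(2)[OF cyclic_order_cyc[OF assms(1)]] by blast
    then show False using that cyclic_orderD(3)[OF cyclic_order_cyc[OF assms(1)]] by blast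
  qed
  show "sorted_wrt ?r v" using sorted_wrt_cyc[OF assms(1)] .
  show "sorted_wrt ?r w" using sorted_wrt_cyc[OF assms(2)] assms(4) by simp
qed fact

text \<open>The same linear order, defined from \<open>R\<close> itself, sorts the remaining elements into a word.  It
  suffices to show that the cyclic order of this word is contained in \<open>R\<close>, since a cyclic order is
  maximal: it contains every triple of distinct elements or the reversed one.\<close>

lemma cyclic_order_is_cyc:
  assumes R: "cyclic_order_on X R" and "finite X" "a \<in> X"
  shows "\<exists>v. distinct (a # v) \<and> set (a # v) = X \<and> cyc (a # v) = R"
proof -
  note D = cyclic_orderD[OF R]
  let ?r = "\<lambda>x y. (a, x, y) \<in> R"
  have "?r x y \<or> ?r y x" if "x \<in> X - {a}" "y \<in> X - {a}" "x \<noteq> y" for x y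
    using D(5)[of a x y] that assms(3) D(2) by blast
  moreover have "?r x z" if "?r x y" "?r y z" for x y z using D(4) that by blast
  ultimately obtain v where v: "distinct v" "set v = X - {a}" "sorted_wrt ?r v"
    using ex_sorted_wrt[of "X - {a}" ?r] assms(2) by blast
  have d: "distinct (a # v)" and s: "set (a # v) = X" using v assms(3) by auto
  have inc: "((a # v) ! i, (a # v) ! j, (a # v) ! k) \<in> R"
    if ijk: "i < j" "j < k" "k < length (a # v)" for i j k
  proof -
    have r: "?r (v ! p) (v ! q)" if "p < q" "q < length v" for p q
      using v(3) that by (auto simp: sorted_wrt_iff_nth_less)
    obtain j' k' where jk: "j = Suc j'" "k = Suc k'"
      using ijk(1,2) by (cases j; cases k) auto
    show ?thesis
    proof (cases i)
      case 0
      then show ?thesis using r[of j' k'] that jk by simp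
    next
      case (Suc i')
      then have "?r (v ! i') (v ! j')" "?r (v ! j') (v ! k')" using r that jk by auto
      then have "(v ! j', v ! k', v ! i') \<in> R" using D(2) D(4) by blast
      then show ?thesis using D(2) Suc jk by simp
    qed
  qed
  have sub: "(x, y, z) \<in> R" if xyz: "(x, y, z) \<in> cyc (a # v)" for x y z
  proof -
    from xyz obtain i j k where *: "x = (a # v) ! i" "y = (a # v) ! j" "z = (a # v) ! k"
      "i < length (a # v)" "j < length (a # v)" "k < length (a # v)" "ccw i j k" by (rule cycE)
    from *(7) consider "i < j" "j < k" | "j < k" "k < i" | "k < i" "i < j"
      unfolding ccw_def by blast
    then show ?thesis unfolding *(1-3)
    proof cases
      case 1
      then show "((a # v) ! i, (a # v) ! j, (a # v) ! k) \<in> R" using inc *(6) by blast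
    next
      case 2
      then show "((a # v) ! i, (a # v) ! j, (a # v) ! k) \<in> R" using D(2)[OF D(2)[OF inc]] *(4) by blast
    next
      case 3
      then show "((a # v) ! i, (a # v) ! j, (a # v) ! k) \<in> R" using D(2)[OF inc] *(5) by blast
    qed
  qed
  have "(x, y, z) \<in> cyc (a # v)" if "(x, y, z) \<in> R" for x y z
  proof (rule ccontr)
    assume "(x, y, z) \<notin> cyc (a # v)"
    then have "(z, y, x) \<in> cyc (a # v)"
      using cyclic_orderD(5)[OF cyclic_order_cyc[OF d], of x y z] D(1)[OF that]
        cyclic_order_distinct[OF R that] unfolding s by blast
    then show False using sub D(3)[OF that] by blast
  qed
  then have "cyc (a # v) = R" using sub by auto
  then show ?thesis using d s by blast
qed

text \<open>Beginning with \<open>0\<close> makes the word of an element unique.  For \<open>q\<close> as part of a morphism, the tail of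
  the word is the linear order of the non-zero legs in which they replace the leg to which leg \<open>0\<close>
  is glued.\<close>

definition is_word :: "nat \<times> (nat \<times> nat \<times> nat) set \<Rightarrow> nat list \<Rightarrow> bool" where
  "is_word p w \<longleftrightarrow> (\<exists>v. w = 0 # v) \<and> distinct w \<and> set w = {..fst p} \<and> cyc w = snd p"

definition word :: "nat \<times> (nat \<times> nat \<times> nat) set \<Rightarrow> nat list" where
  "word p = (THE w. is_word p w)"

lemma is_word_unique:
  assumes "is_word p v" "is_word p w" shows "v = w"
proof -
  obtain v' w' where *: "v = 0 # v'" "w = 0 # w'" using assms by (auto simp: is_word_def)
  have "set u = {..fst p} - {0}" if "is_word p (0 # u)" for u
    using that by (auto simp: is_word_def)
  then have "set v' = set w'" using assms * by simp
  then show ?thesis using cyc_inject[of 0 v' w'] assms * by (auto simp: is_word_def)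
qed

lemma word_eqI: "is_word p w \<Longrightarrow> word p = w"
  unfolding word_def using is_word_unique by blast

abbreviation cyc_obj :: "nat \<times> (nat \<times> nat \<times> nat) set \<Rightarrow> bool" where
  "cyc_obj p \<equiv> cyclic_order_on {..fst p} (snd p)"

lemma is_word_word: 
  assumes "cyc_obj p" shows "is_word p (word p)"
proof -
  obtain v where "is_word p (0 # v)"
    using cyclic_order_is_cyc[OF assms, of 0] unfolding is_word_def by blast
  then show ?thesis using word_eqI[of p "0 # v"] by simp
qed

lemma word_props:
  assumes "cyc_obj p"
  shows "word p = 0 # tl (word p)" "distinct (word p)" "set (word p) = {..fst p}"
    "cyc (word p) = snd p" "length (word p) = Suc (fst p)" "set (tl (word p)) = {1..fst p}"
    "distinct (tl (word p))" "length (tl (word p)) = fst p"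
proof -
  have *: "is_word p (word p)" by (rule is_word_word[OF assms])
  then show 1: "word p = 0 # tl (word p)" and 2: "distinct (word p)"
    and 3: "set (word p) = {..fst p}" and "cyc (word p) = snd p"
    by (auto simp: is_word_def)
  show 4: "length (word p) = Suc (fst p)" using distinct_card[OF 2] 3 by simp
  show "length (tl (word p)) = fst p" using 4 by simp
  have "distinct (0 # tl (word p))" using 1 2 by simp
  moreover have "set (0 # tl (word p)) = {..fst p}" using 1 3 by simp
  moreover have "{1..fst p} = {..fst p} - {0}" by auto
  ultimately show "distinct (tl (word p))" and "set (tl (word p)) = {1..fst p}"
    by auto
qed

lemma word_ne: "cyc_obj p \<Longrightarrow> word p \<noteq> []"
  using word_props(5)[of p] by auto

section \<open>Gluing legs splices words\<close>

type_synonym 'l named = "(nat \<times> nat \<times> nat) set \<times> 'l list"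

text \<open>\<open>w\<close> is a word of the element \<open>fst x\<close>, written with the leg names \<open>snd x\<close>.  The order of the
  list of names, which matters for \<open>reorder\<close> and \<open>glue\<close>, is independent of the order of the letters in \<open>w\<close>.\<close>

definition carries :: "'l named \<Rightarrow> 'l list \<Rightarrow> bool" where
  "carries x w \<longleftrightarrow> distinct (snd x) \<and> distinct w \<and> set (snd x) = set w \<and>
    fst x = {(i, j, k). i < length w \<and> j < length w \<and> k < length w \<and>
      (snd x ! i, snd x ! j, snd x ! k) \<in> cyc w}"

lemma carries_length: "carries x w \<Longrightarrow> length (snd x) = length w"
  by (metis carries_def distinct_card)

lemma carries_commute: "carries x (v @ w) \<Longrightarrow> carries x (w @ v)"
  by (auto simp: carries_def cyc_append_commute[of v w])

lemma carries_cyc: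
  assumes "carries (R, [0..<n]) w"
  shows "R = cyc w"
proof -
  have len: "length w = n" using carries_length[OF assms] by simp
  have w: "set w = {..<n}" using assms unfolding carries_def by (simp add: atLeast0LessThan)
  have R: "R = {(i, j, k). i < length w \<and> j < length w \<and> k < length w \<and>
      ([0..<n] ! i, [0..<n] ! j, [0..<n] ! k) \<in> cyc w}"
    using assms unfolding carries_def by simp
  have "(i, j, k) \<in> R \<longleftrightarrow> (i, j, k) \<in> cyc w" for i j k
  proof -
    have "(i, j, k) \<in> cyc w \<Longrightarrow> i < n \<and> j < n \<and> k < n"
      using cyc_in_set[of i j k w] unfolding w by simp
    then show ?thesis unfolding R len mem_Collect_eq prod.case by (metis add_0 nth_upt)
  qed
  then show ?thesis by (metis subsetI subset_antisym prod_cases3)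
qed

lemma carries_cycI:
  assumes "distinct w" "set w = {..<n}"
  shows "carries (cyc w, [0..<n]) w"
proof -
  have "length w = n" using distinct_card[OF assms(1)] assms(2) by simp
  moreover have "(i, j, k) \<in> cyc w \<Longrightarrow> i < n \<and> j < n \<and> k < n" for i j k
    using cyc_in_set[of i j k w] assms(2) by auto
  ultimately show ?thesis unfolding carries_def using assms by auto
qed

lemma carries_map:
  assumes "carries (R, ls) w" "inj_on f (set w)"
  shows "carries (R, map f ls) (map f w)"
proof -
  have *: "set ls = set w" "length ls = length w" "distinct ls" "distinct w"
    using assms(1) carries_length[OF assms(1)] by (auto simp: carries_def)
  have iff: "(f (ls ! i), f (ls ! j), f (ls ! k)) \<in> cyc (map f w) \<longleftrightarrow> (ls ! i, ls ! j, ls ! k) \<in> cyc w"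
    if "i < length w" "j < length w" "k < length w" for i j k
    by (rule cyc_map_iff[OF assms(2)]) (metis * nth_mem that)+
  show ?thesis using assms * iff by (auto simp: carries_def distinct_map)
qed

lemma carries_word:
  assumes "cyc_obj p" "inj f"
  shows "carries (snd p, map f [0..<Suc (fst p)]) (map f (word p))"
proof -
  note * = word_props[OF assms(1)]
  have "carries (snd p, [0..<Suc (fst p)]) (word p)"
    using carries_cycI[of "word p" "Suc (fst p)"] * by (simp add: lessThan_Suc_atMost)
  then show ?thesis by (rule carries_map) (use assms(2) in \<open>auto intro: inj_on_subset\<close>)
qed

lemma carries_reorder:
  assumes x: "carries x w" and ls': "distinct ls'" "set ls' = set w"
  shows "carries (reorder uAs_c ls' x, ls') w"
proof -
  obtain R ls where x': "x = (R, ls)" by (cases x)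
  have ls: "distinct ls" "distinct w" "set ls = set w" "length ls = length w"
    using x carries_length[OF x] by (auto simp: carries_def x')
  have len: "length ls' = length w" using ls(2) ls' by (metis distinct_card)
  have R: "(i, j, k) \<in> R \<longleftrightarrow> i < length w \<and> j < length w \<and> k < length w \<and>
      (ls ! i, ls ! j, ls ! k) \<in> cyc w" for i j k
    using x by (simp add: carries_def x')
  define \<sigma> where "\<sigma> i = (if i < length ls then (THE k. k < length ls' \<and> ls' ! k = ls ! i) else i)" for i
  have \<sigma>: "\<sigma> i < length w \<and> ls' ! \<sigma> i = ls ! i" if "i < length w" for i
  proof -
    have "ls ! i \<in> set ls'" using that ls ls'(2) by (metis nth_mem)
    then have "\<exists>!k. k < length ls' \<and> ls' ! k = ls ! i"
      using distinct_Ex1[OF ls'(1)] by simp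
    from theI'[OF this] show ?thesis using that ls(4) len by (simp add: \<sigma>_def)
  qed
  have \<sigma>_surj: "\<exists>i < length w. \<sigma> i = k" if k: "k < length w" for k
  proof -
    have "ls' ! k \<in> set ls" using k len ls ls' by (metis nth_mem)
    then obtain i where i: "i < length w" "ls ! i = ls' ! k" using ls(4) by (auto simp: in_set_conv_nth)
    then have "\<sigma> i = k" using \<sigma>[OF i(1)] k len nth_eq_iff_index_eq[OF ls'(1), of "\<sigma> i" k] by simp
    then show ?thesis using i(1) by blast
  qed
  have eq: "reorder uAs_c ls' x = (\<lambda>(i, j, k). (\<sigma> i, \<sigma> j, \<sigma> k)) ` R"
    by (simp add: reorder_def x' uAs_c_def \<sigma>_def)
  have "(i, j, k) \<in> reorder uAs_c ls' x \<longleftrightarrow> i < length w \<and> j < length w \<and> k < length w \<and>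
      (ls' ! i, ls' ! j, ls' ! k) \<in> cyc w" (is "?L \<longleftrightarrow> ?R") for i j k
  proof
    assume ?L
    then show ?R unfolding eq by (auto simp: R \<sigma>)
  next
    assume ?R
    moreover from this obtain i' j' k' where "i = \<sigma> i'" "j = \<sigma> j'" "k = \<sigma> k'"
      "i' < length w" "j' < length w" "k' < length w" using \<sigma>_surj by metis
    ultimately have "(i', j', k') \<in> R" "(i, j, k) = (\<lambda>(i, j, k). (\<sigma> i, \<sigma> j, \<sigma> k)) (i', j', k')"
      using \<sigma> by (auto simp: R)
    then show ?L unfolding eq by blast
  qed
  then show ?thesis using ls ls' by (auto simp: carries_def)
qed

text \<open>In the situation produced by \<open>glue\<close>, \<open>splice_fst\<close> and \<open>splice_snd\<close> collapse, on the level of names,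
  the legs of one of the two elements to \<open>a\<close>; so this is \<open>cyc_append_iff\<close>.\<close>

lemma carries_splice:
  assumes x: "carries (R, ls @ [a]) (v @ [a])" and y: "carries (S, a # ks) (a # w)"
    and disj: "set v \<inter> set w = {}" and ne: "ls \<noteq> []"
  shows "carries (splice_orders (length ls) (length ks) (length ls) R S, ls @ ks) (v @ w)"
proof -
  let ?m = "length ls" and ?n = "length ks"
  have v: "distinct v" "a \<notin> set v" "set ls = set v" "distinct ls"
    using x by (auto simp: carries_def)
  have w: "distinct w" "a \<notin> set w" "set ks = set w" "distinct ks"
    using y by (auto simp: carries_def)
  have len: "length v = ?m" "length w = ?n"
    using carries_length[OF x] carries_length[OF y] by auto
  have d: "distinct (v @ w)" using v w disj by auto
  define f where "f = (\<lambda>x. if x \<in> set v then x else a)"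
  define g where "g = (\<lambda>x. if x \<in> set v then a else x)"
  let ?p = "splice_fst ?n ?m" and ?q = "splice_snd ?n ?m"
  have f: "(ls @ [a]) ! ?p i = f ((ls @ ks) ! i) \<and> ?p i < Suc ?m"
    and g: "(a # ks) ! ?q i = g ((ls @ ks) ! i) \<and> ?q i < Suc ?n"
    if i: "i < ?m + ?n" for i
  proof -
    have "(ls @ ks) ! i \<in> set v \<longleftrightarrow> i < ?m"
    proof (cases "i < ?m")
      case True
      then have "ls ! i \<in> set v" using v(3) nth_mem[of i ls] by simp
      then show ?thesis using True by (simp add: nth_append)
    next
      case False
      then have "ks ! (i - ?m) \<in> set w" using i w(3) nth_mem[of "i - ?m" ks] by simp
      then have "ks ! (i - ?m) \<notin> set v" using disj by blast
      then show ?thesis using False by (simp add: nth_append)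
    qed
    then show "(ls @ [a]) ! ?p i = f ((ls @ ks) ! i) \<and> ?p i < Suc ?m"
      and "(a # ks) ! ?q i = g ((ls @ ks) ! i) \<and> ?q i < Suc ?n"
      using i unfolding f_def g_def splice_fst_def splice_snd_def glued_leg_def
      by (simp_all add: nth_append less_diff_conv2)
  qed
  have R: "(?p i, ?p j, ?p k) \<in> R \<longleftrightarrow>
      (f ((ls @ ks) ! i), f ((ls @ ks) ! j), f ((ls @ ks) ! k)) \<in> cyc (v @ [a])"
    if "i < ?m + ?n" "j < ?m + ?n" "k < ?m + ?n" for i j k
    using x f[OF that(1)] f[OF that(2)] f[OF that(3)] len by (auto simp: carries_def)
  have S: "(?q i, ?q j, ?q k) \<in> S \<longleftrightarrow>
      (g ((ls @ ks) ! i), g ((ls @ ks) ! j), g ((ls @ ks) ! k)) \<in> cyc (a # w)"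
    if "i < ?m + ?n" "j < ?m + ?n" "k < ?m + ?n" for i j k
    using y g[OF that(1)] g[OF that(2)] g[OF that(3)] len by (auto simp: carries_def)
  have mem: "(ls @ ks) ! i \<in> set (v @ w)" if "i < ?m + ?n" for i
    using that v(3) w(3) nth_mem[of i "ls @ ks"] by simp
  have cyc: "((ls @ ks) ! i, (ls @ ks) ! j, (ls @ ks) ! k) \<in> cyc (v @ w) \<longleftrightarrow>
      (?p i, ?p j, ?p k) \<in> R \<or> (?q i, ?q j, ?q k) \<in> S"
    if "i < ?m + ?n" "j < ?m + ?n" "k < ?m + ?n" for i j k
    unfolding R[OF that] S[OF that] unfolding f_def g_def
    by (rule cyc_append_iff[OF d v(2) w(2) mem[OF that(1)] mem[OF that(2)] mem[OF that(3)]])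
  have le: "i \<le> ?m + ?n - 1 \<longleftrightarrow> i < ?m + ?n" for i using ne by (cases ls) auto
  have "splice_orders ?m ?n ?m R S = {(i, j, k). i < length (v @ w) \<and> j < length (v @ w) \<and>
      k < length (v @ w) \<and> ((ls @ ks) ! i, (ls @ ks) ! j, (ls @ ks) ! k) \<in> cyc (v @ w)}"
    unfolding splice_orders_def le length_append len
    by (rule Collect_cong) (auto simp: cyc)
  then show ?thesis using d v w disj by (auto simp: carries_def)
qed

text \<open>Both branches of \<open>glue\<close> give the same cyclic word, since \<open>v @ w\<close> and \<open>w @ v\<close> differ by a rotation.\<close>

lemma carries_glue:
  assumes x: "carries x (a # v)" and y: "carries y (a # w)"
    and disj: "set v \<inter> set w = {}" and ne: "v @ w \<noteq> []"
  shows "carries (glue uAs_c a x y) (v @ w)"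
proof -
  define ls ks where "ls = remove1 a (snd x)" and "ks = remove1 a (snd y)"
  have ls: "distinct ls" "set ls = set v" "a \<notin> set v"
    using x by (auto simp: carries_def ls_def)
  have ks: "distinct ks" "set ks = set w" "a \<notin> set w"
    using y by (auto simp: carries_def ks_def)
  have *: "carries (reorder uAs_c (ls @ [a]) x, ls @ [a]) (v @ [a])"
    "carries (reorder uAs_c (a # ls) x, a # ls) (a # v)"
    using carries_reorder[OF x, of "ls @ [a]"] carries_reorder[OF x, of "a # ls"] ls
      carries_commute[of _ "[a]" v] by auto
  have **: "carries (reorder uAs_c (ks @ [a]) y, ks @ [a]) (w @ [a])"
    "carries (reorder uAs_c (a # ks) y, a # ks) (a # w)"
    using carries_reorder[OF y, of "ks @ [a]"] carries_reorder[OF y, of "a # ks"] ks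
      carries_commute[of _ "[a]" w] by auto
  show ?thesis
  proof (cases "ls = []")
    case False
    then show ?thesis using carries_splice[OF *(1) **(2) disj False]
      unfolding glue_def Let_def ls_def[symmetric] ks_def[symmetric] by (simp add: uAs_c_def)
  next
    case True
    then have "ks \<noteq> []" using ls(2) ks(2) ne by auto
    from carries_commute[OF carries_splice[OF **(1) *(2) _ this]] disj True
    show ?thesis
      unfolding glue_def Let_def ls_def[symmetric] ks_def[symmetric] by (auto simp: uAs_c_def)
  qed
qed

text \<open>The letter \<open>j\<close> of \<open>w\<close> is replaced by the tail of the word of \<open>q j\<close> if \<open>j\<close> is in \<open>js\<close>; the names are
  those of \<open>glue_all\<close>.\<close>

definition grafted :: "nat list \<Rightarrow> (nat \<Rightarrow> nat \<times> (nat \<times> nat \<times> nat) set) \<Rightarrow> nat list \<Rightarrow> (nat \<times> nat) list" where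
  "grafted js q w =
    concat (map (\<lambda>j. if j \<in> set js then map (Pair j) (tl (word (q j))) else [(j, 0)]) w)"

text \<open>The value of \<open>glue\<close> is meaningless if nothing remains after gluing.  This does not happen
  halfway: as long as some \<open>j\<close> in \<open>js\<close> is still to be glued, its leg \<open>(j, 0)\<close> is there, so nonemptiness
  of the final word is enough.\<close>

lemma carries_fold_glue:
  assumes start: "carries x (map (\<lambda>j. (j, 0)) w)"
    and "distinct js" "set js \<subseteq> set w" "\<And>j. j \<in> set js \<Longrightarrow> cyc_obj (q j)" "grafted js q w \<noteq> []"
  shows "carries (fold (\<lambda>j y. glue uAs_c (j, 0) y (snd (q j), map (\<lambda>k. (j, k)) [0..<Suc (fst (q j))])) js x)
    (grafted js q w)"
  using assms(2-)
proof (induction js rule: rev_induct)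
  case Nil
  have "grafted [] q w = map (\<lambda>j. (j, 0)) w" by (simp add: grafted_def)
  then show ?case using start by simp
next
  case (snoc j js)
  have dw: "distinct w" using start by (auto simp: carries_def distinct_map)
  have "j \<in> set w" using snoc.prems by auto
  then obtain u v where w: "w = u @ j # v" by (auto simp: in_set_conv_decomp)
  have j: "j \<notin> set u" "j \<notin> set v" "j \<notin> set js" using dw snoc.prems(1) by (auto simp: w)
  have q: "cyc_obj (q j)" using snoc.prems by auto
  let ?b = "map (Pair j) (tl (word (q j)))"
  have same: "grafted (js @ [j]) q z = grafted js q z" if "j \<notin> set z" for z
    using that unfolding grafted_def by (intro arg_cong[of _ _ concat] map_cong) auto
  have app: "grafted js' q (z @ j # z') = grafted js' q z @ grafted js' q [j] @ grafted js' q z'" for js' z z'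
    by (simp add: grafted_def)
  have old: "grafted js q w = grafted js q u @ [(j, 0)] @ grafted js q v"
    unfolding w app using j by (simp add: grafted_def)
  have new: "grafted (js @ [j]) q w = grafted js q u @ ?b @ grafted js q v"
    unfolding w app same[OF j(1)] same[OF j(2)] by (simp add: grafted_def)
  let ?x = "fold (\<lambda>j y. glue uAs_c (j, 0) y (snd (q j), map (\<lambda>k. (j, k)) [0..<Suc (fst (q j))])) js x"
  \<comment> \<open>Rotate the leg \<open>(j, 0)\<close> to the front, glue, and rotate back.\<close>
  have "carries ?x (grafted js q w)" using snoc old by simp
  then have x: "carries ?x ((j, 0) # grafted js q v @ grafted js q u)"
    using carries_commute[of ?x "grafted js q u" "[(j, 0)] @ grafted js q v"] old by simp
  have "map (Pair j) (word (q j)) = (j, 0) # ?b"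
    using arg_cong[OF word_props(1)[OF q], of "map (Pair j)"] by simp
  then have y: "carries (snd (q j), map (Pair j) [0..<Suc (fst (q j))]) ((j, 0) # ?b)"
    using carries_word[OF q, of "Pair j"] by (simp add: inj_def)
  have "fst ` set (grafted js q z) \<subseteq> set z" for z
    by (auto simp: grafted_def split: if_splits)
  then have "set (grafted js q v @ grafted js q u) \<inter> set ?b = {}"
    using j by fastforce
  from carries_glue[OF x y this]
  have "carries (glue uAs_c (j, 0) ?x (snd (q j), map (Pair j) [0..<Suc (fst (q j))]))
      (grafted js q v @ grafted js q u @ ?b)"
    using snoc.prems(4) new by auto
  then have "carries (glue uAs_c (j, 0) ?x (snd (q j), map (Pair j) [0..<Suc (fst (q j))]))
      (grafted js q u @ ?b @ grafted js q v)"
    using carries_commute[of _ "grafted js q v" "grafted js q u @ ?b"] by simp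
  then show ?case unfolding new by simp
qed

lemma glue_all_uAs_c:
  assumes p: "cyc_obj p" and "distinct js" "set js \<subseteq> {..fst p}" "\<And>j. j \<in> set js \<Longrightarrow> cyc_obj (q j)"
    and ne: "grafted js q (word p) \<noteq> []" and \<beta>: "bij_betw \<beta> (set (grafted js q (word p))) {..<n}"
    and n: "n = length (grafted js q (word p))"
  shows "glue_all uAs_c p js q \<beta> = (n - 1, cyc (map \<beta> (grafted js q (word p))))"
proof -
  let ?w = "grafted js q (word p)"
  define x where "x = fold (\<lambda>j y. glue uAs_c (j, 0) y (snd (q j), map (\<lambda>k. (j, k)) [0..<Suc (fst (q j))])) js
    (snd p, map (\<lambda>j. (j, 0)) [0..<Suc (fst p)])"
  obtain R ls where Rls: "x = (R, ls)" by (cases x)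
  have x: "carries x ?w" unfolding x_def
    by (rule carries_fold_glue[OF carries_word[OF p] assms(2) _ assms(4) ne])
      (use assms(3) word_props(3)[OF p] in \<open>auto simp: inj_def\<close>)
  then have "carries (R, map \<beta> ls) (map \<beta> ?w)"
    using carries_map \<beta> unfolding Rls bij_betw_def by blast
  from carries_reorder[OF this, of "[0..<n]"] \<beta>
  have "carries (reorder uAs_c [0..<n] (R, map \<beta> ls), [0..<n]) (map \<beta> ?w)"
    by (simp add: bij_betw_def atLeast0LessThan)
  then have "reorder uAs_c [0..<n] (R, map \<beta> ls) = cyc (map \<beta> ?w)" by (rule carries_cyc)
  moreover have "length ls = n" using carries_length[OF x] n by (simp add: Rls)
  ultimately show ?thesis
    unfolding glue_all_def x_def[symmetric] Rls by simp
qed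

section \<open>Morphisms as families of blocks\<close>

type_synonym uAs_mor = "(nat \<times> nat \<times> nat) set tw_mor"

definition block :: "uAs_mor \<Rightarrow> nat \<Rightarrow> nat list" where
  "block f j = map (\<lambda>k. snd f (j, k)) (tl (word (fst f ! j)))"

text \<open>The conditions on \<open>(q; lam)\<close> that concern each \<open>q\<^sub>j\<close> separately; what is missing for a morphism is
  that \<open>lam\<close> is a bijection onto an initial segment of the numbers.\<close>

definition tw_shape :: "nat \<Rightarrow> uAs_mor \<Rightarrow> bool" where
  "tw_shape n f \<longleftrightarrow> length (fst f) = Suc n \<and> (\<forall>j\<le>n. cyc_obj (fst f ! j)) \<and>
    snd f \<in> extensional (tw_legs (fst f)) \<and>
    (\<forall>j\<le>n. strict_mono_on {1..fst (fst f ! j)} (\<lambda>k. snd f (j, k)))"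

lemma legs_word:
  assumes f: "tw_shape n f" and w: "distinct w" "set w = {..n}"
  defines "W \<equiv> concat (map (\<lambda>j. map (Pair j) (tl (word (fst f ! j)))) w)"
  shows "distinct W" "set W = tw_legs (fst f)" "length W = sum_list (map fst (fst f))"
    "map (snd f) W = concat (map (block f) w)"
proof -
  have q: "cyc_obj (fst f ! j)" if "j \<in> set w" for j using that f w(2) by (simp add: tw_shape_def)
  have len: "length (fst f) = Suc n" using f by (simp add: tw_shape_def)
  show "set W = tw_legs (fst f)"
  proof -
    have "set W = (\<Union>j\<in>set w. Pair j ` set (tl (word (fst f ! j))))" by (simp add: W_def)
    also have "\<dots> = (\<Union>j\<in>set w. Pair j ` {1..fst (fst f ! j)})"
      using word_props(6)[OF q] by (intro SUP_cong) auto
    also have "\<dots> = tw_legs (fst f)"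
      unfolding w(2) tw_legs_def len by (auto simp: image_iff less_Suc_eq_le)
    finally show ?thesis .
  qed
  show "distinct W"
    unfolding W_def using w(1) q
  proof (induction w)
    case (Cons j w)
    then show ?case using word_props(7)[of "fst f ! j"]
      by (auto simp: distinct_map inj_on_def)
  qed simp
  have "length W = sum_list (map (\<lambda>j. fst (fst f ! j)) w)"
    unfolding W_def length_concat map_map
    by (intro arg_cong[of _ _ sum_list] map_cong) (simp_all add: word_props(8)[OF q] del: length_tl)
  also have "\<dots> = (\<Sum>j\<in>{..n}. fst (fst f ! j))"
    using w by (simp add: sum_list_distinct_conv_sum_set)
  also have "\<dots> = sum_list (map fst (fst f))"
    using len by (simp add: sum_list_sum_nth atLeast0LessThan lessThan_Suc_atMost)
  finally show "length W = sum_list (map fst (fst f))" .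
  show "map (snd f) W = concat (map (block f) w)"
    by (simp add: W_def map_concat block_def[abs_def] comp_def)
qed

text \<open>Being a bijection means that the blocks together contain each number exactly once; the order in
  which they are concatenated is arbitrary here.\<close>

lemma tw_from_iff:
  assumes w: "distinct w" "set w = {..fst p}"
  defines "B \<equiv> \<lambda>f. concat (map (block f) w)"
  shows "f \<in> tw_from uAs_c p \<longleftrightarrow>
    tw_shape (fst p) f \<and> B f \<noteq> [] \<and> distinct (B f) \<and> set (B f) = {..<length (B f)}"
proof (cases "tw_shape (fst p) f")
  case True
  obtain qs lam where f: "f = (qs, lam)" by (cases f)
  note W = legs_word[OF True w, unfolded f fst_conv snd_conv]
  let ?W = "concat (map (\<lambda>j. map (Pair j) (tl (word (qs ! j)))) w)"
  have B: "B f = map lam ?W" using W(4) by (simp add: B_def f)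
  have all: "(\<forall>x\<in>set qs. P x) \<longleftrightarrow> (\<forall>j<Suc (fst p). P (qs ! j))" for P
    using True by (simp add: tw_shape_def f all_set_conv_all_nth)
  have "f \<in> tw_from uAs_c p \<longleftrightarrow>
      1 \<le> sum_list (map fst qs) \<and> bij_betw lam (tw_legs qs) {..<sum_list (map fst qs)}"
    using True unfolding tw_from_def tw_shape_def f mem_Collect_eq prod.case all
    by (auto simp: uAs_c_def less_Suc_eq_le case_prod_unfold)
  also have "\<dots> \<longleftrightarrow> length ?W \<ge> 1 \<and> bij_betw lam (set ?W) {..<length ?W}"
    unfolding W(2,3) ..
  also have "\<dots> \<longleftrightarrow> B f \<noteq> [] \<and> distinct (B f) \<and> set (B f) = {..<length (B f)}"
    unfolding B bij_betw_def distinct_map set_map length_map using W(1) by (auto simp: Suc_le_eq simp del: length_concat length_map)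
  finally show ?thesis using True by simp
next
  case False
  then show ?thesis unfolding tw_from_def tw_shape_def
    by (cases f) (auto simp: uAs_c_def less_Suc_eq_le all_set_conv_all_nth case_prod_unfold)
qed

lemma Hom_Tw: "f \<in> Hom (Tw_cOp uAs_c) p t \<longleftrightarrow> f \<in> tw_from uAs_c p \<and> tw_target uAs_c p f = t"
  by (simp add: Tw_cOp_def)

lemma Obj_Tw: "p \<in> Obj (Tw_cOp uAs_c) \<longleftrightarrow> cyc_obj p"
  by (auto simp: Tw_cOp_def uAs_c_def)

lemma Hom_shape: "cyc_obj p \<Longrightarrow> f \<in> Hom (Tw_cOp uAs_c) p t \<Longrightarrow> tw_shape (fst p) f"
  using tw_from_iff[OF word_props(2,3)] by (auto simp: Hom_Tw)

text \<open>Grafting the words of the \<open>q\<^sub>j\<close> into a word of \<open>p\<close> and renaming the legs by \<open>lam\<close> concatenates the blocks.\<close>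

lemma tw_target_blocks:
  assumes p: "cyc_obj p" and f: "f \<in> tw_from uAs_c p"
  defines "B \<equiv> concat (map (block f) (word p))"
  shows "tw_target uAs_c p f = (length B - 1, cyc B)"
proof -
  note w = word_props(2,3)[OF p]
  have shape: "tw_shape (fst p) f" and B: "B \<noteq> []" "distinct B" "set B = {..<length B}"
    using f tw_from_iff[OF w] unfolding B_def by auto
  note W = legs_word[OF shape w]
  let ?W = "concat (map (\<lambda>j. map (Pair j) (tl (word (fst f ! j)))) (word p))"
  have g: "grafted [0..<Suc (fst p)] (\<lambda>j. fst f ! j) (word p) = ?W"
    unfolding grafted_def by (intro arg_cong[of _ _ concat] map_cong) (use w(2) in auto)
  have BW: "B = map (snd f) ?W" using W(4) by (simp add: B_def)
  have "bij_betw (snd f) (set ?W) {..<length ?W}"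
    using B(2,3) unfolding BW bij_betw_def distinct_map set_map length_map by auto
  then have "glue_all uAs_c p [0..<Suc (fst p)] (\<lambda>j. fst f ! j) (snd f) = (length ?W - 1, cyc (map (snd f) ?W))"
    unfolding g[symmetric]
  proof (intro glue_all_uAs_c[OF p])
    show "cyc_obj (fst f ! j)" if "j \<in> set [0..<Suc (fst p)]" for j
      using that shape by (auto simp: tw_shape_def)
    show "grafted [0..<Suc (fst p)] (\<lambda>j. fst f ! j) (word p) \<noteq> []"
      using B(1) unfolding g BW by simp
  qed auto
  then show ?thesis unfolding BW length_map by (simp add: tw_target_def case_prod_unfold)
qed

definition rank :: "nat set \<Rightarrow> nat \<Rightarrow> nat" where
  "rank A x = card {z \<in> A. z \<le> x}"

lemma sorted_nth_rank:
  assumes "finite A" "x \<in> A"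
  shows "sorted_list_of_set A ! (rank A x - 1) = x"
proof -
  let ?s = "sorted_list_of_set A"
  have s: "set ?s = A" "distinct ?s" "sorted ?s" using assms(1) by auto
  obtain i where i: "i < length ?s" "?s ! i = x" using assms(2) s(1) by (metis in_set_conv_nth)
  have "?s ! j \<le> x \<longleftrightarrow> j \<le> i" if "j < length ?s" for j
    using that i s by (metis nth_eq_iff_index_eq sorted_nth_mono linorder_le_cases order_antisym)
  note le = this
  have "z \<in> A \<and> z \<le> x \<longleftrightarrow> (\<exists>j\<le>i. ?s ! j = z)" for z
  proof
    assume "z \<in> A \<and> z \<le> x"
    then obtain j where "j < length ?s" "?s ! j = z" using s(1) by (metis in_set_conv_nth)
    then show "\<exists>j\<le>i. ?s ! j = z" using le[of j] \<open>z \<in> A \<and> z \<le> x\<close> by blast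
  next
    assume "\<exists>j\<le>i. ?s ! j = z"
    then obtain j where j: "j \<le> i" "?s ! j = z" by blast
    then have "j < length ?s" using i(1) by linarith
    then show "z \<in> A \<and> z \<le> x" using le[of j] j nth_mem[of j ?s] s(1) by blast
  qed
  then have "{z \<in> A. z \<le> x} = (\<lambda>j. ?s ! j) ` {..i}" by (auto simp: image_iff)
  moreover have "inj_on (\<lambda>j. ?s ! j) {..i}"
    by (rule inj_on_nth[OF s(2)]) (use i(1) in auto)
  ultimately have "rank A x = Suc i" by (simp add: rank_def card_image)
  then show ?thesis using i(2) by simp
qed

lemma bij_betw_rank:
  assumes "finite A"
  shows "bij_betw (rank A) A {1..card A}"
proof -
  have inj: "inj_on (rank A) A" by (rule inj_onI) (metis sorted_nth_rank[OF assms])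
  have "rank A x \<in> {1..card A}" if "x \<in> A" for x
  proof -
    have "{z \<in> A. z \<le> x} \<noteq> {}" using that by auto
    then have "rank A x \<noteq> 0" using assms by (simp add: rank_def)
    moreover have "rank A x \<le> card A" unfolding rank_def by (rule card_mono) (use assms in auto)
    ultimately show ?thesis by simp
  qed
  then have "rank A ` A = {1..card A}"
    by (intro card_subset_eq) (auto simp: card_image[OF inj])
  then show ?thesis using inj by (simp add: bij_betw_def)
qed

lemma rank_strict_mono_image:
  assumes "strict_mono_on {1..m} h" "k \<in> {1..m}"
  shows "rank (h ` {1..m}) (h k) = k"
proof -
  have "{z \<in> h ` {1..m}. z \<le> h k} = h ` {1..k}"
    using assms(2) strict_mono_on_less_eq[OF assms(1)] by force
  moreover have "inj_on h {1..k}"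
    by (rule inj_on_subset[OF strict_mono_on_imp_inj_on[OF assms(1)]]) (use assms(2) in auto)
  ultimately show ?thesis by (simp add: rank_def card_image)
qed

lemma sorted_list_strict_mono: "strict_mono_on {1..card A} (\<lambda>k. sorted_list_of_set A ! (k - 1))"
  if "finite A" for A :: "nat set"
proof (rule strict_mono_onI)
  fix i j assume "i \<in> {1..card A}" "j \<in> {1..card A}" "i < j"
  then show "sorted_list_of_set A ! (i - 1) < sorted_list_of_set A ! (j - 1)"
    using sorted_wrt_nth_less[OF strict_sorted_list_of_set, of "i - 1" "j - 1" A] by auto
qed

text \<open>A word without repetitions in arbitrary numbers is the renumbering of a permutation of
  \<open>1, \<dots>, n\<close> by an increasing map in exactly one way: the permutation is given by the ranks of the
  letters, the increasing map is the enumeration of the letters.  So \<open>std_word v\<close> is the word of the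
  element \<open>q\<^sub>j\<close>, and the enumeration of the letters is \<open>lam (j, _)\<close>, for the morphism \<open>std_mor\<close> with
  the prescribed blocks \<open>E j\<close>.\<close>

definition std_word :: "nat list \<Rightarrow> nat list" where
  "std_word v = 0 # map (rank (set v)) v"

definition std_mor :: "nat \<Rightarrow> (nat \<Rightarrow> nat list) \<Rightarrow> uAs_mor" where
  "std_mor n E = (let qs = map (\<lambda>j. (length (E j), cyc (std_word (E j)))) [0..<Suc n] in
    (qs, restrict (\<lambda>(j, k). sorted_list_of_set (set (E j)) ! (k - 1)) (tw_legs qs)))"

lemma std_word:
  assumes "distinct v"
  shows "distinct (std_word v)" "set (std_word v) = {..length v}" "word (length v, cyc (std_word v)) = std_word v"
    "cyc_obj (length v, cyc (std_word v))"
proof -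
  have r: "bij_betw (rank (set v)) (set v) {1..length v}"
    using bij_betw_rank[of "set v"] distinct_card[OF assms] by simp
  then have s: "rank (set v) ` set v = {1..length v}" by (simp add: bij_betw_def)
  then show d: "distinct (std_word v)"
    using r assms by (auto simp: std_word_def distinct_map bij_betw_def)
  show s': "set (std_word v) = {..length v}" using s by (auto simp: std_word_def)
  show "word (length v, cyc (std_word v)) = std_word v"
    by (rule word_eqI) (use d s' in \<open>auto simp: is_word_def std_word_def\<close>)
  show "cyc_obj (length v, cyc (std_word v))" using cyclic_order_cyc[OF d] s' by simp
qed

lemma fst_std_mor: "fst (std_mor n E) = map (\<lambda>j. (length (E j), cyc (std_word (E j)))) [0..<Suc n]"
  by (simp add: std_mor_def Let_def)

lemma snd_std_mor_restrict: "snd (std_mor n E) =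
    restrict (\<lambda>(j, k). sorted_list_of_set (set (E j)) ! (k - 1)) (tw_legs (fst (std_mor n E)))"
  by (simp add: std_mor_def Let_def)

lemma std_mor_nth: "j \<le> n \<Longrightarrow> fst (std_mor n E) ! j = (length (E j), cyc (std_word (E j)))"
  by (simp add: fst_std_mor nth_map_upt del: upt_Suc)

lemma snd_std_mor:
  assumes "j \<le> n" "k \<in> {1..length (E j)}"
  shows "snd (std_mor n E) (j, k) = sorted_list_of_set (set (E j)) ! (k - 1)"
proof -
  have "(j, k) \<in> tw_legs (fst (std_mor n E))"
    using assms by (simp add: tw_legs_def std_mor_nth) (simp add: fst_std_mor)
  then show ?thesis by (simp add: std_mor_def Let_def del: upt_Suc)
qed

lemma block_std_mor:
  assumes "j \<le> n" "distinct (E j)"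
  shows "block (std_mor n E) j = E j"
proof -
  have r: "rank (set (E j)) x \<in> {1..length (E j)}" if "x \<in> set (E j)" for x
    using bij_betw_apply[OF bij_betw_rank[of "set (E j)"] that] distinct_card[OF assms(2)] by simp
  have "block (std_mor n E) j = map (\<lambda>x. snd (std_mor n E) (j, rank (set (E j)) x)) (E j)"
    using assms by (simp add: block_def std_mor_nth std_word(3)) (simp add: std_word_def)
  also have "\<dots> = E j"
  proof (rule map_idI)
    fix x assume "x \<in> set (E j)"
    then show "snd (std_mor n E) (j, rank (set (E j)) x) = x"
      using snd_std_mor[of j n _ E, OF assms(1) r] sorted_nth_rank[of "set (E j)" x] by simp
  qed
  finally show ?thesis .
qed

lemma std_mor_cong: "(\<And>j. j \<le> n \<Longrightarrow> E j = E' j) \<Longrightarrow> std_mor n E = std_mor n E'"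
proof -
  assume E: "\<And>j. j \<le> n \<Longrightarrow> E j = E' j"
  then have fst: "fst (std_mor n E) = fst (std_mor n E')"
    unfolding fst_std_mor by (intro map_cong) auto
  have "snd (std_mor n E) = snd (std_mor n E')"
    unfolding snd_std_mor_restrict fst
    by (rule restrict_ext) (use E in \<open>auto simp: tw_legs_def fst_std_mor less_Suc_eq_le simp del: upt_Suc\<close>)
  with fst show ?thesis by (rule prod_eqI)
qed

lemma tw_shape_std_mor:
  assumes "\<And>j. j \<le> n \<Longrightarrow> distinct (E j)"
  shows "tw_shape n (std_mor n E)"
  unfolding tw_shape_def
proof (intro conjI allI impI)
  show "length (fst (std_mor n E)) = Suc n" by (simp add: std_mor_def Let_def)
  show "snd (std_mor n E) \<in> extensional (tw_legs (fst (std_mor n E)))"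
    by (simp add: std_mor_def Let_def)
  fix j assume j: "j \<le> n"
  show "cyc_obj (fst (std_mor n E) ! j)" using std_word(4)[OF assms[OF j]] j by (simp add: std_mor_nth)
  show "strict_mono_on {1..fst (fst (std_mor n E) ! j)} (\<lambda>k. snd (std_mor n E) (j, k))"
    using sorted_list_strict_mono[of "set (E j)"] distinct_card[OF assms[OF j]]
    by (simp add: std_mor_nth[OF j] snd_std_mor[OF j] strict_mono_on_def)
qed

text \<open>Since \<open>lam (j, _)\<close> is increasing, \<open>k\<close> is the rank of \<open>lam (j, k)\<close> in the \<open>j\<close>-th block; hence both
  \<open>q\<^sub>j\<close> and \<open>lam\<close> can be recovered from the block.\<close>

lemma std_mor_blocks:
  assumes f: "tw_shape n f"
  shows "std_mor n (block f) = f"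
proof -
  have q: "cyc_obj (fst f ! j)" and mono: "strict_mono_on {1..fst (fst f ! j)} (\<lambda>k. snd f (j, k))"
    if "j \<le> n" for j using f that by (auto simp: tw_shape_def)
  have len: "length (block f j) = fst (fst f ! j)" if "j \<le> n" for j
    using word_props(8)[OF q[OF that]] by (simp add: block_def)
  have set: "set (block f j) = (\<lambda>k. snd f (j, k)) ` {1..fst (fst f ! j)}" if "j \<le> n" for j
    using word_props(6)[OF q[OF that]] by (simp add: block_def)
  have rank: "rank (set (block f j)) (snd f (j, k)) = k" if "j \<le> n" "k \<in> {1..fst (fst f ! j)}" for j k
    unfolding set[OF that(1)] by (rule rank_strict_mono_image[OF mono[OF that(1)] that(2)])
  have sw: "std_word (block f j) = word (fst f ! j)" if "j \<le> n" for j
  proof -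
    have "map (rank (set (block f j))) (block f j) = map (\<lambda>k. rank (set (block f j)) (snd f (j, k))) (tl (word (fst f ! j)))"
      by (simp add: block_def)
    also have "\<dots> = tl (word (fst f ! j))"
      by (rule map_idI) (use rank[OF that] word_props(6)[OF q[OF that]] in blast)
    finally show ?thesis using word_props(1)[OF q[OF that]] by (simp add: std_word_def)
  qed
  have "fst (std_mor n (block f)) = fst f"
  proof (rule nth_equalityI)
    show "length (fst (std_mor n (block f))) = length (fst f)"
      using f by (simp add: fst_std_mor tw_shape_def)
    fix j assume "j < length (fst (std_mor n (block f)))"
    then have j: "j \<le> n" by (simp add: fst_std_mor)
    show "fst (std_mor n (block f)) ! j = fst f ! j"
      unfolding std_mor_nth[OF j] sw[OF j] len[OF j] word_props(4)[OF q[OF j]] by simp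
  qed
  moreover have "snd (std_mor n (block f)) = snd f"
  proof (rule extensionalityI)
    show "snd f \<in> extensional (tw_legs (fst f))" using f by (simp add: tw_shape_def)
    show "snd (std_mor n (block f)) \<in> extensional (tw_legs (fst f))"
      unfolding calculation[symmetric] by (simp add: std_mor_def Let_def)
    fix x assume "x \<in> tw_legs (fst f)"
    then obtain j k where x: "x = (j, k)" "j \<le> n" "k \<in> {1..fst (fst f ! j)}"
      using f by (auto simp: tw_legs_def tw_shape_def)
    have "snd (std_mor n (block f)) (j, k) = sorted_list_of_set (set (block f j)) ! (rank (set (block f j)) (snd f (j, k)) - 1)"
      using x snd_std_mor[of j n k "block f"] rank[OF x(2,3)] len[OF x(2)] by simp
    also have "\<dots> = snd f (j, k)"
      by (rule sorted_nth_rank) (use x set[OF x(2)] in auto)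
    finally show "snd (std_mor n (block f)) x = snd f x" by (simp add: x)
  qed
  ultimately show ?thesis by (rule prod_eqI)
qed

text \<open>Leg \<open>k\<close> of \<open>q\<^sub>j\<close> is replaced by the non-zero legs of \<open>r\<close> at \<open>lam (j, k)\<close>, which are finally numbered by
  the corresponding block of \<open>g\<close>.  The renumbering in the definition of the composite, by ranks
  and by the enumeration of \<open>tw_comp_nums\<close>, is the one of \<open>std_mor\<close>.\<close>

lemma tw_comp_std_mor:
  assumes f: "tw_shape n f" and g: "tw_shape m g"
    and range: "\<And>j. j \<le> n \<Longrightarrow> set (block f j) \<subseteq> {..m}"
  defines "E \<equiv> \<lambda>j. concat (map (block g) (block f j))"
  assumes dist: "\<And>j. j \<le> n \<Longrightarrow> distinct (E j)"
  shows "tw_comp uAs_c g f = std_mor n E"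
proof -
  have len: "length (fst f) = Suc n" using f by (simp add: tw_shape_def)
  have elem: "tw_comp_nums f g j = set (E j)"
    "tw_comp_elem uAs_c f g j = (length (E j), cyc (std_word (E j)))" if j: "j \<le> n" for j
  proof -
    have q: "cyc_obj (fst f ! j)" using f j by (simp add: tw_shape_def)
    define v where "v = tl (word (fst f ! j))"
    have v: "word (fst f ! j) = 0 # v" "set v = {1..fst (fst f ! j)}"
      using word_props(1,6)[OF q] by (auto simp: v_def)
    let ?r = "\<lambda>k. fst g ! snd f (j, k)"
    have bf: "block f j = map (\<lambda>k. snd f (j, k)) v" by (simp add: block_def v_def)
    have le: "snd f (j, k) \<le> m" if "k \<in> set v" for k
      using range[OF j] that by (auto simp: bf)
    have r: "cyc_obj (?r k)" if "k \<in> set v" for k using g le[OF that] by (simp add: tw_shape_def)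
    have E: "E j = concat (map (\<lambda>k. map (\<lambda>l. snd g (snd f (j, k), l)) (tl (word (?r k)))) v)"
      unfolding E_def bf by (simp add: block_def[abs_def] comp_def)
    have "set (E j) = (\<Union>k\<in>{1..fst (fst f ! j)}. (\<lambda>l. snd g (snd f (j, k), l)) ` {1..fst (?r k)})"
      unfolding E using word_props(6)[OF r] v(2) by simp
    then show nums: "tw_comp_nums f g j = set (E j)"
      unfolding tw_comp_nums_def case_prod_unfold by auto blast+
    \<comment> \<open>Leg \<open>0\<close> of \<open>q\<^sub>j\<close> is not glued; it keeps the name \<open>(0, 0)\<close> and becomes leg \<open>0\<close> of the composite.\<close>
    define W where "W = (0, 0) # concat (map (\<lambda>k. map (Pair k) (tl (word (?r k)))) v)"
    have W: "grafted [1..<Suc (fst (fst f ! j))] ?r (word (fst f ! j)) = W"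
    proof -
      have eq: "map (\<lambda>k. if k \<in> set [1..<Suc (fst (fst f ! j))] then map (Pair k) (tl (word (?r k))) else [(k, 0)]) v
          = map (\<lambda>k. map (Pair k) (tl (word (?r k)))) v"
        by (rule map_cong) (use v(2) in auto)
      have "0 \<notin> set [1..<Suc (fst (fst f ! j))]" by simp
      then show ?thesis unfolding grafted_def v(1) W_def list.map concat.simps eq
        by (simp del: set_upt upt_Suc)
    qed
    define \<beta> where "\<beta> = (\<lambda>(k, l). if k = 0 then 0 else rank (set (E j)) (snd g (snd f (j, k), l)))"
    have "map \<beta> (concat (map (\<lambda>k. map (Pair k) (tl (word (?r k)))) v)) = map (rank (set (E j))) (E j)"
    proof -
      have eq: "map (map \<beta>) (map (\<lambda>k. map (Pair k) (tl (word (?r k)))) v) =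
          map (map (rank (set (E j)))) (map (\<lambda>k. map (\<lambda>l. snd g (snd f (j, k), l)) (tl (word (?r k)))) v)"
        unfolding map_map by (rule map_cong) (use v(2) in \<open>auto simp: \<beta>_def\<close>)
      show ?thesis unfolding map_concat eq unfolding map_concat[symmetric] E[symmetric] ..
    qed
    then have \<beta>W: "map \<beta> W = std_word (E j)"
      by (simp add: W_def std_word_def) (simp add: \<beta>_def)
    have lenW: "length W = Suc (length (E j))"
      using arg_cong[OF \<beta>W, of length] unfolding std_word_def length_map list.size by simp
    have bij: "bij_betw \<beta> (set W) {..<length W}"
      using std_word(1,2)[OF dist[OF j]] unfolding \<beta>W[symmetric] lenW distinct_map bij_betw_def
      by (auto simp: lessThan_Suc_atMost)
    have "tw_comp_elem uAs_c f g j = glue_all uAs_c (fst f ! j) [1..<Suc (fst (fst f ! j))] ?r \<beta>"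
      unfolding tw_comp_elem_def case_prod_unfold \<beta>_def rank_def nums[symmetric] fst_conv snd_conv ..
    also have "\<dots> = (length W - 1, cyc (map \<beta> W))"
    proof (rule glue_all_uAs_c[OF q, of "[1..<Suc (fst (fst f ! j))]" ?r \<beta> "length W", unfolded W, OF _ _ _ _ bij])
      show "cyc_obj (?r k)" if "k \<in> set [1..<Suc (fst (fst f ! j))]" for k
        by (rule r) (use that v(2) in auto)
    qed (auto simp: W_def)
    finally show "tw_comp_elem uAs_c f g j = (length (E j), cyc (std_word (E j)))"
      unfolding \<beta>W lenW by simp
  qed
  have "map (tw_comp_elem uAs_c f g) [0..<length (fst f)] = fst (std_mor n E)"
    unfolding len std_mor_def Let_def fst_conv by (rule map_cong) (use elem(2) in auto)
  moreover have "restrict (\<lambda>(j, i). sorted_list_of_set (tw_comp_nums f g j) ! (i - 1)) (tw_legs (fst (std_mor n E)))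
      = snd (std_mor n E)"
    unfolding std_mor_def Let_def fst_conv snd_conv
    by (rule restrict_ext) (auto simp: tw_legs_def elem(1))
  ultimately show ?thesis by (simp add: tw_comp_def Let_def prod_eq_iff)
qed

section \<open>The cyclic category\<close>

definition lifts :: "nat \<Rightarrow> nat \<Rightarrow> (int \<Rightarrow> int) set" where
  "lifts m n = {f. mono f \<and> (\<forall>x. f (x + (int m + 1)) = f x + (int n + 1))}"

lemma lifts_mult:
  assumes "f \<in> lifts m n"
  shows "f (x + k * (int m + 1)) = f x + k * (int n + 1)"
proof (induction k arbitrary: x rule: int_induct[where k = 0])
  case (step1 i)
  have "f (x + (i + 1) * (int m + 1)) = f ((x + i * (int m + 1)) + (int m + 1))"
    by (simp add: algebra_simps)
  also have "\<dots> = f (x + i * (int m + 1)) + (int n + 1)" using assms unfolding lifts_def by blast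
  finally show ?case using step1(2)[of x] by (simp add: algebra_simps)
next
  case (step2 i)
  have "f (x + i * (int m + 1)) = f ((x + (i - 1) * (int m + 1)) + (int m + 1))"
    by (simp add: algebra_simps)
  also have "\<dots> = f (x + (i - 1) * (int m + 1)) + (int n + 1)" using assms unfolding lifts_def by blast
  finally show ?case using step2(2)[of x] by (simp add: algebra_simps)
qed simp

lemma lifts_mono: "g \<in> lifts m n \<Longrightarrow> x \<le> y \<Longrightarrow> g x \<le> g y"
  unfolding lifts_def by (blast dest: monoD)

lemma lifts_period: "g \<in> lifts m n \<Longrightarrow> g (x + (int m + 1)) = g x + (int n + 1)"
  unfolding lifts_def by blast

lemma lifts_step:
  assumes "g \<in> lifts m n"
  shows "g (y + 1) \<le> g y + int (Suc n)"
  using lifts_mono[OF assms, of "y + 1" "y + (int m + 1)"] unfolding lifts_period[OF assms] by simp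

lemma lifts_id: "id \<in> lifts n n"
  by (simp add: lifts_def mono_def)

lemma lifts_comp: "f \<in> lifts m n \<Longrightarrow> g \<in> lifts n l \<Longrightarrow> g \<circ> f \<in> lifts m l"
  by (simp add: lifts_def mono_def)

lemma lifts_shift: "f \<in> lifts m n \<Longrightarrow> (\<lambda>x. f x + c) \<in> lifts m n"
  by (simp add: lifts_def mono_def)

lemma shift_classI: "(\<lambda>x. f x + k * (int n + 1)) \<in> shift_class n f"
  by (auto simp: shift_class_def)

lemma shift_class_self: "f \<in> shift_class n f"
  using shift_classI[of f 0 n] by simp

text \<open>Composition in \<open>Lambda_cat\<close> is defined on whole classes; periodicity of \<open>g\<close> turns a shift of \<open>f\<close> by
  periods into a shift of \<open>g \<circ> f\<close> by periods, so the composite of two classes is a single class.\<close>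

lemma shift_class_comp:
  assumes "f \<in> lifts m n" "g \<in> lifts n l"
  shows "{g' \<circ> f' | g' f'. g' \<in> shift_class l g \<and> f' \<in> shift_class n f} = shift_class l (g \<circ> f)"
proof -
  have "(\<lambda>x. g x + b * (int l + 1)) \<circ> (\<lambda>x. f x + a * (int n + 1)) = (\<lambda>x. (g \<circ> f) x + (a + b) * (int l + 1))" for a b
    by (rule ext) (simp only: o_apply lifts_mult[OF assms(2)] distrib_right add.assoc)
  then have 1: "{g' \<circ> f' | g' f'. g' \<in> shift_class l g \<and> f' \<in> shift_class n f} \<subseteq> shift_class l (g \<circ> f)"
    by (auto simp: shift_class_def)
  have "h \<in> {g' \<circ> f' | g' f'. g' \<in> shift_class l g \<and> f' \<in> shift_class n f}" if h: "h \<in> shift_class l (g \<circ> f)" for h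
  proof -
    from h obtain k where "h = (\<lambda>x. g x + k * (int l + 1)) \<circ> f"
      by (auto simp: shift_class_def o_def)
    then show ?thesis using shift_classI[of g k l] shift_class_self[of f n] by blast
  qed
  then show ?thesis using 1 by blast
qed

lemma Hom_Lambda: "Hom Lambda_cat m n = shift_class n ` lifts m n"
  by (auto simp: Lambda_cat_def lifts_def)

lemma Ident_Lambda: "Ident Lambda_cat n = shift_class n id"
  by (simp add: Lambda_cat_def)

lemma Comp_Lambda:
  "f \<in> lifts m n \<Longrightarrow> g \<in> lifts n l \<Longrightarrow>
    Comp Lambda_cat (shift_class l g) (shift_class n f) = shift_class l (g \<circ> f)"
  using shift_class_comp[of f m n g l] by (simp add: Lambda_cat_def)

lemma category_Lambda: "category Lambda_cat"
proof
  show "Ident Lambda_cat n \<in> Hom Lambda_cat n n" for n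
    by (simp add: Hom_Lambda Ident_Lambda lifts_id)
  show "Comp Lambda_cat g f \<in> Hom Lambda_cat a c"
    if "f \<in> Hom Lambda_cat a b" "g \<in> Hom Lambda_cat b c" for a b c f g
    using that by (auto simp: Hom_Lambda Comp_Lambda intro!: imageI lifts_comp)
  show "Comp Lambda_cat f (Ident Lambda_cat a) = f" if "f \<in> Hom Lambda_cat a b" for a b f
    using that Comp_Lambda[OF lifts_id] by (auto simp: Hom_Lambda Ident_Lambda)
  show "Comp Lambda_cat (Ident Lambda_cat b) f = f" if "f \<in> Hom Lambda_cat a b" for a b f
    using that Comp_Lambda[OF _ lifts_id] by (auto simp: Hom_Lambda Ident_Lambda)
  show "Comp Lambda_cat (Comp Lambda_cat h g) f = Comp Lambda_cat h (Comp Lambda_cat g f)"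
    if "f \<in> Hom Lambda_cat a b" "g \<in> Hom Lambda_cat b c" "h \<in> Hom Lambda_cat c d" for a b c d f g h
  proof -
    from that obtain f' g' h' where *: "f = shift_class b f'" "f' \<in> lifts a b" "g = shift_class c g'" "g' \<in> lifts b c"
      "h = shift_class d h'" "h' \<in> lifts c d" by (auto simp: Hom_Lambda)
    show ?thesis
      unfolding * Comp_Lambda[OF *(2,4)] Comp_Lambda[OF *(4,6)] Comp_Lambda[OF *(2) lifts_comp[OF *(4,6)]]
        Comp_Lambda[OF lifts_comp[OF *(2,4)] *(6)] comp_assoc ..
  qed
qed

section \<open>Arcs of periodic words\<close>

definition unroll :: "'a list \<Rightarrow> int \<Rightarrow> 'a" where
  "unroll w x = w ! nat (x mod int (length w))"

definition arc :: "'a list \<Rightarrow> int \<Rightarrow> int \<Rightarrow> 'a list" where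
  "arc w a b = map (unroll w) [a..b - 1]"

lemma length_arc [simp]: "length (arc w a b) = nat (b - a)"
  by (simp add: arc_def)

lemma nth_arc: "i < nat (b - a) \<Longrightarrow> arc w a b ! i = unroll w (a + int i)"
  by (simp add: arc_def)

lemma unroll_shift: "unroll w (x + k * int (length w)) = unroll w x"
  by (simp add: unroll_def)

lemma unroll_eq_iff:
  assumes "distinct w" "w \<noteq> []"
  shows "unroll w x = unroll w y \<longleftrightarrow> x mod int (length w) = y mod int (length w)"
proof -
  have L: "int (length w) > 0" using assms(2) by simp
  have "nat (x mod int (length w)) < length w" for x
    using pos_mod_bound[OF L, of x] pos_mod_sign[OF L, of x] by linarith
  then have "unroll w x = unroll w y \<longleftrightarrow> nat (x mod int (length w)) = nat (y mod int (length w))"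
    unfolding unroll_def using nth_eq_iff_index_eq[OF assms(1)] by blast
  then show ?thesis using pos_mod_sign[OF L] by (metis nat_eq_iff2 int_nat_eq)
qed

lemma unroll_in_set: "w \<noteq> [] \<Longrightarrow> unroll w x \<in> set w"
  unfolding unroll_def by (rule nth_mem) (simp add: nat_less_iff)

lemma unroll_int: "i < length w \<Longrightarrow> unroll w (int i) = w ! i"
  by (simp add: unroll_def zmod_int[symmetric] del: of_nat_mod)

lemma arc_shift: "arc w (a + k * int (length w)) (b + k * int (length w)) = arc w a b"
proof (rule nth_equalityI)
  fix i assume "i < length (arc w (a + k * int (length w)) (b + k * int (length w)))"
  moreover have "unroll w (a + k * int (length w) + int i) = unroll w (a + int i)"
    using unroll_shift[of w "a + int i" k] by (simp add: ac_simps)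
  ultimately show "arc w (a + k * int (length w)) (b + k * int (length w)) ! i = arc w a b ! i"
    by (simp add: nth_arc)
qed simp

lemma arc_append:
  assumes "a \<le> b" "b \<le> c"
  shows "arc w a b @ arc w b c = arc w a c"
proof -
  have "[a..c - 1] = [a..b - 1] @ [b..c - 1]"
    by (cases "c = b") (use assms upto_split1[of a b "c - 1"] in auto)
  then show ?thesis by (simp add: arc_def)
qed

text \<open>Consecutive arcs telescope.  This accounts both for the target of a morphism, as the arcs of one
  period of \<open>p\<close> make up one period of \<open>t\<close>, and for composition, as a block of a composite is a
  concatenation of consecutive arcs.\<close>

lemma concat_arcs:
  assumes "mono h" "a \<le> b"
  shows "concat (map (\<lambda>x. arc w (h x) (h (x + 1))) [a..b - 1]) = arc w (h a) (h b)"
  using assms(2)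
proof (induction b rule: int_ge_induct)
  case base
  then show ?case by (simp add: arc_def)
next
  case (step b)
  have "[a..b + 1 - 1] = [a..b - 1] @ [b]" using step.hyps upto_rec2[of a b] by simp
  then show ?case using step.IH arc_append[of "h a" "h b" "h (b + 1)" w] step.hyps monoD[OF assms(1)]
    by simp
qed

lemma rotate_arc: "arc w (int s) (int s + int (length w)) = rotate s w"
proof (rule nth_equalityI)
  fix i assume "i < length (arc w (int s) (int s + int (length w)))"
  then have "i < length w" by simp
  then show "arc w (int s) (int s + int (length w)) ! i = rotate s w ! i"
    by (simp add: nth_arc nth_rotate unroll_def zmod_int[symmetric] nat_mod_distrib nat_add_distrib)
qed simp

lemma full_arc: "w \<noteq> [] \<Longrightarrow> \<exists>s. arc w a (a + int (length w)) = rotate s w"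
proof -
  assume w: "w \<noteq> []"
  let ?L = "int (length w)"
  have s: "int (nat (a mod ?L)) = a mod ?L" using w by simp
  have a: "a = a mod ?L + a div ?L * ?L" by simp
  have "arc w (a mod ?L + a div ?L * ?L) (a mod ?L + ?L + a div ?L * ?L) = rotate (nat (a mod ?L)) w"
    unfolding arc_shift using rotate_arc[of w "nat (a mod ?L)"] unfolding s .
  moreover have "a mod ?L + ?L + a div ?L * ?L = a + ?L" using a by linarith
  ultimately show ?thesis using a by metis
qed

lemma distinct_arc:
  assumes "distinct w" "b \<le> a + int (length w)"
  shows "distinct (arc w a b)"
proof (cases "w \<noteq> [] \<and> a \<le> b")
  case True
  then obtain s where "arc w a (a + int (length w)) = rotate s w" using full_arc by metis
  moreover have "arc w a (a + int (length w)) = arc w a b @ arc w b (a + int (length w))"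
    using True assms(2) arc_append by metis
  moreover have "distinct (rotate s w)" using assms(1) by simp
  ultimately show ?thesis by (metis distinct_append)
next
  case False
  then have "b \<le> a" using assms(2) by auto
  then show ?thesis by (simp add: arc_def)
qed

lemma sub_arc:
  assumes "i + l \<le> nat (b - a)"
  shows "arc w (a + int i) (a + int i + int l) = take l (drop i (arc w a b))"
  by (rule nth_equalityI) (use assms in \<open>auto simp: nth_arc add.assoc\<close>)

section \<open>Morphisms and their lifts\<close>

text \<open>The map \<open>g\<close> records where the blocks of \<open>f\<close> begin in the periodic word of \<open>t\<close>: the block at
  position \<open>y\<close> of the periodic word of \<open>p\<close> occupies the places from \<open>g y\<close> to \<open>g (y + 1) - 1\<close>.\<close>

definition tracks ::
  "nat \<times> (nat \<times> nat \<times> nat) set \<Rightarrow> nat \<times> (nat \<times> nat \<times> nat) set \<Rightarrow> uAs_mor \<Rightarrow> (int \<Rightarrow> int) \<Rightarrow> bool" where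
  "tracks p t f g \<longleftrightarrow> g \<in> lifts (fst p) (fst t) \<and>
    (\<forall>y. arc (word t) (g y) (g (y + 1)) = block f (unroll (word p) y))"

lemma unroll_le: "cyc_obj p \<Longrightarrow> unroll (word p) y \<le> fst p"
  using unroll_in_set[OF word_ne, of p y] word_props(3)[of p] by auto

lemma ex_unroll:
  assumes "cyc_obj p" "j \<le> fst p"
  shows "\<exists>y. unroll (word p) y = j"
proof -
  have "j \<in> set (word p)" using assms word_props(3) by auto
  then obtain i where "i < length (word p)" "word p ! i = j" by (metis in_set_conv_nth)
  then show ?thesis using unroll_int by metis
qed

lemma distinct_lift_arc:
  assumes "cyc_obj t" "g \<in> lifts m (fst t)"
  shows "distinct (arc (word t) (g y) (g (y + 1)))"
  using word_props(2,5)[OF assms(1)] lifts_step[OF assms(2), of y] by (intro distinct_arc) auto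

lemma word_arc: "cyc_obj p \<Longrightarrow> map (unroll (word p)) [0..int (fst p)] = word p"
  using rotate_arc[of "word p" 0] word_props(5)[of p] by (simp add: arc_def)

lemma tracks_blocks:
  assumes p: "cyc_obj p" and t: "cyc_obj t" and g: "tracks p t f g"
  shows "concat (map (block f) (word p)) = arc (word t) (g 0) (g 0 + int (Suc (fst t)))"
proof -
  have lift: "g \<in> lifts (fst p) (fst t)" using g by (simp add: tracks_def)
  then have mono: "mono g" and per: "g (0 + (int (fst p) + 1)) = g 0 + (int (fst t) + 1)"
    unfolding lifts_def by blast+
  have "concat (map (block f) (word p)) = concat (map (block f) (map (unroll (word p)) [0..int (fst p)]))"
    by (simp only: word_arc[OF p])
  also have "\<dots> = concat (map (\<lambda>x. arc (word t) (g x) (g (x + 1))) [0..(int (fst p) + 1) - 1])"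
    using g by (simp add: tracks_def comp_def)
  also have "\<dots> = arc (word t) (g 0) (g (int (fst p) + 1))"
    by (rule concat_arcs[OF mono]) simp
  finally show ?thesis using per by (simp add: algebra_simps)
qed

text \<open>The blocks along one period of \<open>p\<close> make up one full turn of the word of \<open>t\<close>.  This gives both the
  bijectivity of the numbering and the target.\<close>

lemma tracks_imp_Hom:
  assumes p: "cyc_obj p" and t: "cyc_obj t" and f: "tw_shape (fst p) f" and g: "tracks p t f g"
  shows "f \<in> Hom (Tw_cOp uAs_c) p t"
proof -
  let ?B = "concat (map (block f) (word p))"
  have len: "length (word t) = Suc (fst t)" by (rule word_props(5)[OF t])
  obtain s where B: "?B = rotate s (word t)"
    using tracks_blocks[OF p t g] full_arc[OF word_ne[OF t]] len by metis
  have "f \<in> tw_from uAs_c p"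
    unfolding tw_from_iff[OF word_props(2,3)[OF p]] B
    using f word_props(2,3)[OF t] len word_ne[OF t] by (simp add: lessThan_Suc_atMost)
  moreover from tw_target_blocks[OF p this] have "tw_target uAs_c p f = t"
    unfolding B using len word_props(2,4)[OF t] by (simp add: cyc_rotate)
  ultimately show ?thesis by (simp add: Hom_Tw)
qed

text \<open>The concatenated blocks \<open>B\<close> are a word of \<open>t\<close>, hence the rotation of \<open>word t\<close> by some \<open>s\<close>.  So \<open>g\<close>
  starts with \<open>s\<close> at \<open>0\<close> and increases by the lengths of the blocks.\<close>

lemma ex_tracks:
  assumes p: "cyc_obj p" and t: "cyc_obj t" and f: "f \<in> Hom (Tw_cOp uAs_c) p t"
  shows "\<exists>g. tracks p t f g"
proof -
  let ?wp = "word p" and ?wt = "word t" and ?n = "int (fst p) + 1" and ?m = "int (fst t) + 1"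
  define B where "B = concat (map (block f) ?wp)"
  have from_p: "f \<in> tw_from uAs_c p" and target: "tw_target uAs_c p f = t" using f by (auto simp: Hom_Tw)
  have B: "B \<noteq> []" "distinct B" "set B = {..<length B}"
    using from_p unfolding tw_from_iff[OF word_props(2,3)[OF p]] B_def by auto
  have tB: "t = (length B - 1, cyc B)" using target tw_target_blocks[OF p from_p] by (simp add: B_def)
  have lenB: "length B = Suc (fst t)" and cycB: "cyc B = snd t" using B(1) by (simp_all add: tB)
  have "0 \<in> set B" using B(1,3) by auto
  then obtain b c where bc: "B = b @ 0 # c" by (auto simp: in_set_conv_decomp)
  then have rot: "rotate (length b) B = 0 # c @ b" by (simp add: rotate_append)
  have "is_word t (rotate (length b) B)"
    unfolding is_word_def
  proof (intro conjI)
    show "\<exists>v. rotate (length b) B = 0 # v" using rot by blast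
    show "set (rotate (length b) B) = {..fst t}" using B(3) lenB by (simp add: lessThan_Suc_atMost)
  qed (simp_all add: B(2) cyc_rotate cycB)
  then have wt: "?wt = 0 # c @ b" using word_eqI rot by simp
  define s where "s = length c + 1"
  have "B = rotate s ?wt"
    unfolding wt s_def using rotate_append[of "0 # c" b] bc by simp
  then have arcB: "arc ?wt (int s) (int s + ?m) = B"
    using rotate_arc[of ?wt s] word_props(5)[OF t] by (simp add: add.commute)
  define c where "c i = length (concat (map (block f) (take i ?wp)))" for i
  have c_Suc: "c (Suc i) = c i + length (block f (?wp ! i))" if "i < Suc (fst p)" for i
    using that word_props(5)[OF p] by (simp add: c_def take_Suc_conv_app_nth)
  have c_end: "c (Suc (fst p)) = Suc (fst t)"
    using lenB word_props(5)[OF p] by (simp add: c_def B_def)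
  define g where "g y = int s + ?m * (y div ?n) + int (c (nat (y mod ?n)))" for y
  have npos: "?n > 0" by simp
  have g_step: "g (y + 1) = g y + int (length (block f (unroll ?wp y)))" for y
  proof -
    define i where "i = nat (y mod ?n)"
    have i: "y mod ?n = int i" "i < Suc (fst p)"
      using pos_mod_sign[OF npos, of y] pos_mod_bound[OF npos, of y] by (auto simp: i_def)
    have u: "unroll ?wp y = ?wp ! i"
      using i(1) word_props(5)[OF p] by (simp add: unroll_def add.commute)
    have y: "y = ?n * (y div ?n) + int i" using i(1) by (metis mult_div_mod_eq)
    show ?thesis
    proof (cases "i = fst p")
      case False
      then have lt: "int (Suc i) < ?n" using i(2) by simp
      have eq: "y + 1 = ?n * (y div ?n) + int (Suc i)" using y by linarith
      have "(y + 1) div ?n = y div ?n" "(y + 1) mod ?n = int (Suc i)"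
        using int_div_pos_eq[OF eq _ lt] int_mod_pos_eq[OF eq _ lt] by simp_all
      then show ?thesis using c_Suc[OF i(2)] u i(1) by (simp add: g_def del: of_nat_Suc)
    next
      case True
      have eq: "y + 1 = ?n * (y div ?n + 1) + 0" using y True by (simp add: distrib_left)
      have "(y + 1) div ?n = y div ?n + 1" "(y + 1) mod ?n = 0"
        using int_div_pos_eq[OF eq _ npos] int_mod_pos_eq[OF eq _ npos] by simp_all
      moreover have "c (Suc i) = Suc (fst t)" using c_end True by simp
      moreover have "c 0 = 0" by (simp add: c_def)
      ultimately show ?thesis using c_Suc[OF i(2)] u i(1) by (simp add: g_def distrib_left)
    qed
  qed
  have "g y \<le> g (y + int k)" for y k
  proof (induction k)
    case (Suc k)
    then show ?case using g_step[of "y + int k"] by (simp add: add.assoc add.commute[of 1])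
  qed simp
  then have "mono g" by (intro monoI) (metis zle_iff_zadd)
  moreover have "g (y + ?n) = g y + ?m" for y
  proof -
    have "(y + ?n) div ?n = y div ?n + 1" "(y + ?n) mod ?n = y mod ?n"
      using npos by (simp_all only: div_add_self2 mod_add_self2 less_irrefl)
    then show ?thesis by (simp add: g_def distrib_left)
  qed
  ultimately have lift: "g \<in> lifts (fst p) (fst t)" by (simp add: lifts_def)
  have "arc ?wt (g y) (g (y + 1)) = block f (unroll ?wp y)" for y
  proof -
    define i where "i = nat (y mod ?n)"
    have i: "i < length ?wp"
      using pos_mod_sign[OF npos, of y] pos_mod_bound[OF npos, of y] word_props(5)[OF p]
      by (auto simp: i_def)
    have u: "unroll ?wp y = ?wp ! i"
      using word_props(5)[OF p] by (simp add: unroll_def i_def add.commute)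
    define l where "l = length (block f (?wp ! i))"
    have split: "?wp = take i ?wp @ ?wp ! i # drop (Suc i) ?wp" using i by (rule id_take_nth_drop)
    have Bs: "B = concat (map (block f) (take i ?wp)) @ block f (?wp ! i) @ concat (map (block f) (drop (Suc i) ?wp))"
      unfolding B_def by (subst split) simp
    have "c i + l \<le> length B"
      unfolding Bs c_def l_def by simp
    then have le: "c i + l \<le> nat (int s + ?m - int s)" using lenB by simp
    have "arc ?wt (g y) (g (y + 1)) = arc ?wt (int s + int (c i) + (y div ?n) * int (length ?wt))
        (int s + int (c i) + int l + (y div ?n) * int (length ?wt))"
      unfolding g_step u l_def[symmetric] using word_props(5)[OF t]
      by (simp add: g_def i_def algebra_simps)
    also have "\<dots> = take l (drop (c i) B)"
      unfolding arc_shift sub_arc[OF le] arcB ..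
    also have "\<dots> = block f (?wp ! i)" unfolding Bs c_def l_def by simp
    finally show ?thesis unfolding u .
  qed
  then show ?thesis using lift unfolding tracks_def by blast
qed

text \<open>The blocks determine the differences \<open>g (y + 1) - g y\<close>, and the first letter of a nonempty block
  determines \<open>g y\<close> modulo the period.  There is a nonempty block because \<open>g\<close> is not constant.\<close>

lemma tracks_unique_lift:
  assumes p: "cyc_obj p" and t: "cyc_obj t" and g: "tracks p t f g"
  shows "{g'. tracks p t f g'} = shift_class (fst t) g"
proof
  let ?m = "int (fst t) + 1"
  have len: "int (length (word t)) = ?m" using word_props(5)[OF t] by simp
  have g_lift: "g \<in> lifts (fst p) (fst t)" using g by (simp add: tracks_def)
  show "shift_class (fst t) g \<subseteq> {g'. tracks p t f g'}"
  proof
    fix h assume "h \<in> shift_class (fst t) g"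
    then obtain k where h: "h = (\<lambda>x. g x + k * ?m)" by (auto simp: shift_class_def)
    show "h \<in> {g'. tracks p t f g'}"
      using g lifts_shift[OF g_lift] arc_shift[of "word t" _ k] unfolding len
      by (simp add: tracks_def h)
  qed
  show "{g'. tracks p t f g'} \<subseteq> shift_class (fst t) g"
  proof
    fix h assume "h \<in> {g'. tracks p t f g'}"
    then have h: "tracks p t f h" by simp
    have h_lift: "h \<in> lifts (fst p) (fst t)" using h by (simp add: tracks_def)
    have arcs: "arc (word t) (g y) (g (y + 1)) = arc (word t) (h y) (h (y + 1))" for y
      using g h by (simp add: tracks_def)
    have le: "g y \<le> g (y + 1)" "h y \<le> h (y + 1)" for y
      using g_lift h_lift by (auto simp: lifts_def intro: monoD)
    have step: "h (y + 1) - g (y + 1) = h y - g y" for y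
      using arg_cong[OF arcs[of y], of length] le[of y] by simp
    have const: "h y - g y = h 0 - g 0" for y
    proof (induction y rule: int_induct[where k = 0])
      case (step1 i) then show ?case using step[of i] by simp
    next
      case (step2 i) then show ?case using step[of "i - 1"] by simp
    qed simp
    have "\<exists>y. g y < g (y + 1)"
    proof (rule ccontr)
      assume "\<nexists>y. g y < g (y + 1)"
      then have "g (y + 1) = g y" for y using le(1)[of y] by (metis order_le_less)
      then have "g (0 + int k) = g 0" for k
        by (induction k) (simp_all add: add.commute[of 1])
      from this[of "Suc (fst p)"] have "g (0 + (int (fst p) + 1)) = g 0" by (simp add: add.commute)
      then show False using lifts_period[OF g_lift, of 0] by simp
    qed
    then obtain y where y: "g y < g (y + 1)" by blast
    then have "unroll (word t) (g y) = unroll (word t) (h y)"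
      using arg_cong[OF arcs[of y], of "\<lambda>v. v ! 0"] step[of y] by (simp add: nth_arc)
    then have "h y mod ?m = g y mod ?m"
      using unroll_eq_iff[OF word_props(2)[OF t] word_ne[OF t]] len by simp
    then have "?m dvd h y - g y" by (simp add: mod_eq_dvd_iff)
    then obtain k where k: "h y - g y = ?m * k" by (auto simp: dvd_def)
    have "h = (\<lambda>x. g x + k * ?m)"
    proof
      fix x
      show "h x = g x + k * ?m" using const[of x] const[of y] k by (simp add: mult.commute)
    qed
    then show "h \<in> shift_class (fst t) g" by (auto simp: shift_class_def)
  qed
qed

lemma tracks_inject:
  assumes p: "cyc_obj p" and "f \<in> Hom (Tw_cOp uAs_c) p t" "f' \<in> Hom (Tw_cOp uAs_c) p t"
    and "tracks p t f g" "tracks p t f' g"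
  shows "f = f'"
proof -
  have "block f j = block f' j" if j: "j \<le> fst p" for j
    using ex_unroll[OF p j] assms(4,5) unfolding tracks_def by metis
  then have "std_mor (fst p) (block f) = std_mor (fst p) (block f')" by (rule std_mor_cong)
  then show ?thesis using std_mor_blocks Hom_shape[OF p] assms(2,3) by metis
qed

text \<open>Prescribe the arcs cut out by \<open>g\<close> as blocks.  As \<open>g\<close> is compatible with the periods, it does not
  matter at which position \<open>Y j\<close> of the leg \<open>j\<close> the arc is taken.\<close>

lemma ex_tracked:
  assumes p: "cyc_obj p" and t: "cyc_obj t" and g: "g \<in> lifts (fst p) (fst t)"
  shows "\<exists>f \<in> Hom (Tw_cOp uAs_c) p t. tracks p t f g"
proof -
  obtain Y where Y: "\<And>j. j \<le> fst p \<Longrightarrow> unroll (word p) (Y j) = j" using ex_unroll[OF p] by metis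
  define E where "E j = arc (word t) (g (Y j)) (g (Y j + 1))" for j
  have dist: "distinct (E j)" for j unfolding E_def by (rule distinct_lift_arc[OF t g])
  let ?f = "std_mor (fst p) E"
  have "arc (word t) (g y) (g (y + 1)) = block ?f (unroll (word p) y)" for y
  proof -
    let ?j = "unroll (word p) y"
    have j: "?j \<le> fst p" by (rule unroll_le[OF p])
    have "y mod int (length (word p)) = Y ?j mod int (length (word p))"
      using Y[OF j] unroll_eq_iff[OF word_props(2)[OF p] word_ne[OF p]] by metis
    then have "int (length (word p)) dvd y - Y ?j" by (simp add: mod_eq_dvd_iff)
    then obtain k where "y - Y ?j = k * int (length (word p))" by (metis dvd_def mult.commute)
    then have y: "y = Y ?j + k * (int (fst p) + 1)" "y + 1 = Y ?j + 1 + k * (int (fst p) + 1)"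
      using word_props(5)[OF p] by (simp_all add: add.commute)
    have len: "int (length (word t)) = int (fst t) + 1" using word_props(5)[OF t] by simp
    have "g y = g (Y ?j) + k * int (length (word t))"
      unfolding len lifts_mult[OF g, symmetric] by (rule arg_cong[OF y(1)])
    moreover have "g (y + 1) = g (Y ?j + 1) + k * int (length (word t))"
      unfolding len lifts_mult[OF g, symmetric] by (rule arg_cong[OF y(2)])
    ultimately have "arc (word t) (g y) (g (y + 1)) = E ?j" by (simp only: arc_shift E_def)
    then show ?thesis using block_std_mor[where E = E, OF j dist] by simp
  qed
  then have "tracks p t ?f g" using g by (simp add: tracks_def)
  then show ?thesis using tracks_imp_Hom[OF p t tw_shape_std_mor[where E = E, OF dist]] by blast
qed

text \<open>The block of the composite at \<open>y\<close> is the concatenation of the arcs of \<open>h\<close> at the positions from \<open>g y\<close>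
  to \<open>g (y + 1) - 1\<close>, which is the arc from \<open>h (g y)\<close> to \<open>h (g (y + 1))\<close>.\<close>

lemma tracks_comp:
  assumes p: "cyc_obj p" and t: "cyc_obj t" and u: "cyc_obj u"
    and f: "f \<in> Hom (Tw_cOp uAs_c) p t" "tracks p t f g"
    and f': "f' \<in> Hom (Tw_cOp uAs_c) t u" "tracks t u f' h"
  shows "tw_comp uAs_c f' f \<in> Hom (Tw_cOp uAs_c) p u" "tracks p u (tw_comp uAs_c f' f) (h \<circ> g)"
proof -
  define E where "E = (\<lambda>j. concat (map (block f') (block f j)))"
  have lift: "h \<circ> g \<in> lifts (fst p) (fst u)"
    using f(2) f'(2) by (auto simp: tracks_def intro: lifts_comp)
  have E: "E (unroll (word p) y) = arc (word u) ((h \<circ> g) y) ((h \<circ> g) (y + 1))" for y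
  proof -
    have "E (unroll (word p) y) = concat (map (block f') (arc (word t) (g y) (g (y + 1))))"
      using f(2) by (simp add: E_def tracks_def)
    also have "\<dots> = concat (map (\<lambda>x. arc (word u) (h x) (h (x + 1))) [g y..g (y + 1) - 1])"
      using f'(2) by (simp add: arc_def[of "word t"] tracks_def comp_def)
    also have "\<dots> = arc (word u) (h (g y)) (h (g (y + 1)))"
      by (rule concat_arcs) (use f(2) f'(2) in \<open>auto simp: tracks_def lifts_def intro: monoD\<close>)
    finally show ?thesis by simp
  qed
  have dist: "distinct (E j)" if j: "j \<le> fst p" for j
    using ex_unroll[OF p j] E distinct_lift_arc[OF u lift] by metis
  have "set (block f j) \<subseteq> {..fst t}" if j: "j \<le> fst p" for j
  proof -
    obtain y where "unroll (word p) y = j" using ex_unroll[OF p j] by blast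
    then have "block f j = arc (word t) (g y) (g (y + 1))" using f(2) by (simp add: tracks_def)
    then show ?thesis using unroll_le[OF t] by (auto simp: arc_def)
  qed
  then have comp: "tw_comp uAs_c f' f = std_mor (fst p) E"
    unfolding E_def
    by (rule tw_comp_std_mor[OF Hom_shape[OF p f(1)] Hom_shape[OF t f'(1)]])
      (use dist in \<open>simp_all add: E_def\<close>)
  show tr: "tracks p u (tw_comp uAs_c f' f) (h \<circ> g)"
    unfolding tracks_def comp using lift E block_std_mor[where E = E, OF unroll_le[OF p] dist[OF unroll_le[OF p]]] by simp
  show "tw_comp uAs_c f' f \<in> Hom (Tw_cOp uAs_c) p u"
    by (rule tracks_imp_Hom[OF p u _ tr]) (use tw_shape_std_mor[OF dist] comp in simp)
qed

lemma tracks_ident: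
  assumes p: "cyc_obj p"
  shows "tw_ident uAs_c p \<in> Hom (Tw_cOp uAs_c) p p" "tracks p p (tw_ident uAs_c p) id"
proof -
  let ?f = "tw_ident uAs_c p"
  have fst: "fst ?f = replicate (Suc (fst p)) (1, {})"
    and snd: "snd ?f = restrict fst (tw_legs (fst ?f))"
    by (simp_all add: tw_ident_def uAs_c_def Let_def)
  have nth: "fst ?f ! j = (1, {})" if "j \<le> fst p" for j unfolding fst using that by (simp del: replicate_Suc)
  have w: "is_word (1, {}) [0, 1]"
    by (auto simp: is_word_def cyc_def ccw_def)
  then have word: "word (1, {}) = [0, 1]" by (rule word_eqI)
  have leg: "snd ?f (j, 1) = j" if "j \<le> fst p" for j
    using nth[OF that] that unfolding snd by (simp add: tw_legs_def fst)
  have "cyc_obj (1, {})" using cyclic_order_cyc[of "[0, 1 :: nat]"] w by (simp add: is_word_def)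
  then have shape: "tw_shape (fst p) ?f"
    unfolding tw_shape_def using nth snd by (auto simp: fst strict_mono_on_def)
  have "arc (word p) y (y + 1) = block ?f (unroll (word p) y)" for y
    using unroll_le[OF p, of y] by (simp add: block_def nth word leg arc_def del: One_nat_def)
  then show tr: "tracks p p ?f id" by (simp add: tracks_def lifts_id)
  show "?f \<in> Hom (Tw_cOp uAs_c) p p" by (rule tracks_imp_Hom[OF p p shape tr])
qed

section \<open>The equivalence\<close>

text \<open>A fully faithful functor that is surjective on objects is an equivalence.  The axioms of a
  category for \<open>C\<close> are reflected by such a functor, so that for the twisted arrow category only
  closure under composition has to be checked, and not, for instance, associativity.\<close>

lemma equivalent_categoriesI:
  assumes D: "category D"
    and Ident: "\<And>a. a \<in> Obj C \<Longrightarrow> Ident C a \<in> Hom C a a"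
    and Comp: "\<And>a b c f g. \<lbrakk>a \<in> Obj C; b \<in> Obj C; c \<in> Obj C; f \<in> Hom C a b; g \<in> Hom C b c\<rbrakk>
      \<Longrightarrow> Comp C g f \<in> Hom C a c"
    and F: "is_functor C D F"
    and ff: "\<And>a b. \<lbrakk>a \<in> Obj C; b \<in> Obj C\<rbrakk>
      \<Longrightarrow> bij_betw (FHom F a b) (Hom C a b) (Hom D (FObj F a) (FObj F b))"
    and surj: "\<And>d. d \<in> Obj D \<Longrightarrow> \<exists>a\<in>Obj C. FObj F a = d"
  shows "equivalent_categories C D"
proof -
  interpret D: category D by (rule D)
  have FO: "FObj F a \<in> Obj D" if "a \<in> Obj C" for a
    using F that by (simp add: is_functor_def)
  have FH: "FHom F a b f \<in> Hom D (FObj F a) (FObj F b)"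
    if "a \<in> Obj C" "b \<in> Obj C" "f \<in> Hom C a b" for a b f
    using F that by (simp add: is_functor_def)
  have FI: "FHom F a a (Ident C a) = Ident D (FObj F a)" if "a \<in> Obj C" for a
    using F that by (simp add: is_functor_def)
  have FC: "FHom F a c (Comp C g f) = Comp D (FHom F b c g) (FHom F a b f)"
    if "a \<in> Obj C" "b \<in> Obj C" "c \<in> Obj C" "f \<in> Hom C a b" "g \<in> Hom C b c" for a b c f g
    using F that unfolding is_functor_def by blast
  have inj: "f = g" if "a \<in> Obj C" "b \<in> Obj C" "f \<in> Hom C a b" "g \<in> Hom C a b"
    "FHom F a b f = FHom F a b g" for a b f g
    using ff[OF that(1,2)] that(3-) by (auto simp: bij_betw_def dest: inj_onD)
  have C: "category C"
  proof
    fix a b f assume *: "a \<in> Obj C" "b \<in> Obj C" "f \<in> Hom C a b"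
    show "Comp C f (Ident C a) = f"
      by (rule inj[of a b]) (use * in \<open>simp_all add: Comp[of a a] Ident FC[of a a b] FI FO FH D.Comp_Ident[of _ "FObj F b"]\<close>)
    show "Comp C (Ident C b) f = f"
      by (rule inj[of a b]) (use * in \<open>simp_all add: Comp[of a b] Ident FC[of a b b] FI FO FH D.Ident_Comp[of "FObj F a"]\<close>)
  next
    fix a b c d f g h
    assume *: "a \<in> Obj C" "b \<in> Obj C" "c \<in> Obj C" "d \<in> Obj C" "f \<in> Hom C a b" "g \<in> Hom C b c" "h \<in> Hom C c d"
    have gf: "Comp C g f \<in> Hom C a c" and hg: "Comp C h g \<in> Hom C b d"
      using * Comp by blast+
    show "Comp C (Comp C h g) f = Comp C h (Comp C g f)"
    proof (rule inj[of a d])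
      have "FHom F a d (Comp C (Comp C h g) f) = Comp D (Comp D (FHom F c d h) (FHom F b c g)) (FHom F a b f)"
        using FC[OF *(1,2,4,5) hg] FC[OF *(2,3,4,6,7)] by simp
      also have "\<dots> = Comp D (FHom F c d h) (Comp D (FHom F b c g) (FHom F a b f))"
        by (rule D.Comp_assoc[OF FO[OF *(1)] FO[OF *(2)] FO[OF *(3)] FO[OF *(4)]
            FH[OF *(1,2,5)] FH[OF *(2,3,6)] FH[OF *(3,4,7)]])
      also have "\<dots> = FHom F a d (Comp C h (Comp C g f))"
        using FC[OF *(1,3,4) gf *(7)] FC[OF *(1,2,3,5,6)] by simp
      finally show "FHom F a d (Comp C (Comp C h g) f) = FHom F a d (Comp C h (Comp C g f))" .
    qed (fact *(1) *(4) Comp[OF *(1,2,4,5) hg] Comp[OF *(1,3,4) gf *(7)])+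
  qed (fact Ident Comp)+
  obtain G where G: "\<And>d. d \<in> Obj D \<Longrightarrow> G d \<in> Obj C \<and> FObj F (G d) = d"
    using surj by metis
  define L where "L a b = inv_into (Hom C a b) (FHom F a b)" for a b
  have L: "L a b u \<in> Hom C a b" "FHom F a b (L a b u) = u"
    if "a \<in> Obj C" "b \<in> Obj C" "u \<in> Hom D (FObj F a) (FObj F b)" for a b u
  proof -
    have "u \<in> FHom F a b ` Hom C a b" using ff[OF that(1,2)] that(3) by (auto simp: bij_betw_def)
    then show "L a b u \<in> Hom C a b" "FHom F a b (L a b u) = u"
      unfolding L_def by (rule inv_into_into, rule f_inv_into_f)
  qed
  have L_Ident: "L a a (Ident D (FObj F a)) = Ident C a" if "a \<in> Obj C" for a
    by (rule inj[of a a]) (use that in \<open>simp_all add: L FO D.Ident_in_Hom Ident FI\<close>)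
  have L_Comp: "L a c (Comp D v u) = Comp C (L b c v) (L a b u)"
    if *: "a \<in> Obj C" "b \<in> Obj C" "c \<in> Obj C" "u \<in> Hom D (FObj F a) (FObj F b)"
      "v \<in> Hom D (FObj F b) (FObj F c)" for a b c u v
  proof -
    have vu: "Comp D v u \<in> Hom D (FObj F a) (FObj F c)"
      using D.Comp_in_Hom[of "FObj F a" "FObj F b" "FObj F c"] * FO by blast
    note u = L[OF *(1,2,4)] and v = L[OF *(2,3,5)] and vu = L[OF *(1,3) vu]
    show ?thesis
      by (rule inj[OF *(1,3) vu(1) Comp[OF *(1-3) u(1) v(1)]])
        (simp add: vu(2) FC[OF *(1-3) u(1) v(1)] u(2) v(2))
  qed
  define GF where "GF = \<lparr>FObj = G, FHom = (\<lambda>d e u. L (G d) (G e) u)\<rparr>"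
  have GF: "is_functor D C GF"
    unfolding is_functor_def GF_def func.simps
  proof (intro conjI ballI)
    fix d assume d: "d \<in> Obj D"
    show "G d \<in> Obj C" using G d by blast
    show "L (G d) (G d) (Ident D d) = Ident C (G d)" using L_Ident[of "G d"] G[OF d] by simp
    fix e u assume e: "e \<in> Obj D" and u: "u \<in> Hom D d e"
    show "L (G d) (G e) u \<in> Hom C (G d) (G e)" using L(1) G[OF d] G[OF e] u by simp
    fix c v assume c: "c \<in> Obj D" and v: "v \<in> Hom D e c"
    show "L (G d) (G c) (Comp D v u) = Comp C (L (G e) (G c) v) (L (G d) (G e) u)"
      using L_Comp[of "G d" "G e" "G c" u v] G[OF d] G[OF e] G[OF c] u v by simp
  qed
  \<comment> \<open>The unit is the lift of an identity; the counit is an identity, as \<open>F (G d) = d\<close>.\<close>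
  define \<eta> where "\<eta> a = L a (G (FObj F a)) (Ident D (FObj F a))" for a
  define \<theta> where "\<theta> a = L (G (FObj F a)) a (Ident D (FObj F a))" for a
  have G': "G (FObj F a) \<in> Obj C" "FObj F (G (FObj F a)) = FObj F a" if "a \<in> Obj C" for a
    using G[OF FO[OF that]] by auto
  have IF: "Ident D (FObj F a) \<in> Hom D (FObj F a) (FObj F a)"
    "Comp D (Ident D (FObj F a)) (Ident D (FObj F a)) = Ident D (FObj F a)" if "a \<in> Obj C" for a
    using D.Ident_in_Hom[OF FO[OF that]] D.Comp_Ident[OF FO[OF that] FO[OF that]] by auto
  have \<eta>: "\<eta> a \<in> Hom C a (G (FObj F a))" if "a \<in> Obj C" for a
    using L(1)[OF that G'(1)[OF that]] IF(1)[OF that] G'(2)[OF that] by (simp add: \<eta>_def)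
  have \<theta>: "\<theta> a \<in> Hom C (G (FObj F a)) a" if "a \<in> Obj C" for a
    using L(1)[OF G'(1)[OF that] that] IF(1)[OF that] G'(2)[OF that] by (simp add: \<theta>_def)
  have "nat_iso C C id_func (comp_func GF F) \<eta>"
    unfolding nat_iso_def id_func_def comp_func_def GF_def func.simps
  proof (intro conjI ballI)
    fix a assume a: "a \<in> Obj C"
    have "Comp C (\<theta> a) (\<eta> a) = Ident C a"
      using L_Comp[OF a G'(1)[OF a] a, of "Ident D (FObj F a)" "Ident D (FObj F a)"]
        IF[OF a] G'(2)[OF a] L_Ident[OF a] by (simp add: \<theta>_def \<eta>_def)
    moreover have "Comp C (\<eta> a) (\<theta> a) = Ident C (G (FObj F a))"
      using L_Comp[OF G'(1)[OF a] a G'(1)[OF a], of "Ident D (FObj F a)" "Ident D (FObj F a)"]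
        IF[OF a] G'(2)[OF a] L_Ident[OF G'(1)[OF a]] by (simp add: \<theta>_def \<eta>_def)
    ultimately show "is_iso C a (G (FObj F a)) (\<eta> a)"
      unfolding is_iso_def using \<eta>[OF a] \<theta>[OF a] by blast
    fix b f assume b: "b \<in> Obj C" and f: "f \<in> Hom C a b"
    note u = FH[OF a b f]
    have "f = L a b (FHom F a b f)"
      by (rule inj[OF a b f]) (use L[OF a b u] in simp_all)
    then have "Comp C (\<eta> b) f = L a (G (FObj F b)) (Comp D (Ident D (FObj F b)) (FHom F a b f))"
      using L_Comp[OF a b G'(1)[OF b] u, of "Ident D (FObj F b)"] IF[OF b] G'(2)[OF b]
      by (simp add: \<eta>_def)
    also have "Comp D (Ident D (FObj F b)) (FHom F a b f) = Comp D (FHom F a b f) (Ident D (FObj F a))"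
      using D.Ident_Comp[OF FO[OF a] FO[OF b] u] D.Comp_Ident[OF FO[OF a] FO[OF b] u] by simp
    also have "L a (G (FObj F b)) \<dots> = Comp C (L (G (FObj F a)) (G (FObj F b)) (FHom F a b f)) (\<eta> a)"
      using L_Comp[OF a G'(1)[OF a] G'(1)[OF b], of "Ident D (FObj F a)" "FHom F a b f"]
        IF[OF a] G'(2)[OF a] G'(2)[OF b] u by (simp add: \<eta>_def)
    finally show "Comp C (\<eta> b) f = Comp C (L (G (FObj F a)) (G (FObj F b)) (FHom F a b f)) (\<eta> a)" .
  qed
  moreover have "nat_iso D D (comp_func F GF) id_func (Ident D)"
    unfolding nat_iso_def id_func_def comp_func_def GF_def func.simps
  proof (intro conjI ballI)
    fix d assume d: "d \<in> Obj D"
    have "Comp D (Ident D d) (Ident D d) = Ident D d"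
      using D.Ident_Comp[OF d d D.Ident_in_Hom[OF d]] .
    then show "is_iso D (FObj F (G d)) d (Ident D d)"
      unfolding is_iso_def using D.Ident_in_Hom[OF d] G[OF d] by auto
    fix e u assume e: "e \<in> Obj D" and u: "u \<in> Hom D d e"
    have "FHom F (G d) (G e) (L (G d) (G e) u) = u" using L(2) G[OF d] G[OF e] u by simp
    then show "Comp D (Ident D e) (FHom F (G d) (G e) (L (G d) (G e) u)) = Comp D u (Ident D d)"
      using D.Ident_Comp[OF d e u] D.Comp_Ident[OF d e u] by simp
  qed
  ultimately show ?thesis unfolding equivalent_categories_def using C D F GF by blast
qed

text \<open>The set of all lifts of a morphism is a full shift class, that is, a morphism of \<open>Lambda_cat\<close>.\<close>

definition to_Lambda :: "(nat \<times> (nat \<times> nat \<times> nat) set, uAs_mor, nat, (int \<Rightarrow> int) set) func" where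
  "to_Lambda = \<lparr>FObj = fst, FHom = (\<lambda>p t f. {g. tracks p t f g})\<rparr>"

lemma FHom_to_Lambda:
  assumes "cyc_obj p" "cyc_obj t" "tracks p t f g"
  shows "FHom to_Lambda p t f = shift_class (fst t) g"
  using tracks_unique_lift[OF assms] by (simp add: to_Lambda_def)

theorem proposition2p30:
  shows "equivalent_categories (Tw_cOp uAs_c) Lambda_cat"
proof (rule equivalent_categoriesI)
  let ?C = "Tw_cOp uAs_c" and ?F = to_Lambda
  have Id: "Ident ?C = tw_ident uAs_c" and Co: "Comp ?C = tw_comp uAs_c"
    and FO: "FObj ?F = fst" by (simp_all add: Tw_cOp_def to_Lambda_def)
  have OL: "n \<in> Obj Lambda_cat" for n by (simp add: Lambda_cat_def)
  show "category Lambda_cat" by (rule category_Lambda)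
  show "Ident ?C p \<in> Hom ?C p p" if "p \<in> Obj ?C" for p
    using tracks_ident(1) that by (simp add: Obj_Tw Id)
  show "Comp ?C f' f \<in> Hom ?C p u"
    if "p \<in> Obj ?C" "t \<in> Obj ?C" "u \<in> Obj ?C" "f \<in> Hom ?C p t" "f' \<in> Hom ?C t u" for p t u f f'
    using that ex_tracks tracks_comp(1) unfolding Obj_Tw Co by metis
  have FHom: "FHom ?F p t f \<in> Hom Lambda_cat (fst p) (fst t)"
    if pt: "cyc_obj p" "cyc_obj t" and f: "f \<in> Hom ?C p t" for p t f
  proof -
    obtain g where g: "tracks p t f g" using ex_tracks[OF pt f] by blast
    then show ?thesis using FHom_to_Lambda[OF pt g] by (simp add: Hom_Lambda tracks_def)
  qed
  have FIdent: "FHom ?F p p (tw_ident uAs_c p) = Ident Lambda_cat (fst p)" if "cyc_obj p" for p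
    using FHom_to_Lambda[OF that that tracks_ident(2)[OF that]] by (simp add: Ident_Lambda)
  have FComp: "FHom ?F p u (tw_comp uAs_c f' f) = Comp Lambda_cat (FHom ?F t u f') (FHom ?F p t f)"
    if p: "cyc_obj p" and t: "cyc_obj t" and u: "cyc_obj u"
      and f: "f \<in> Hom ?C p t" and f': "f' \<in> Hom ?C t u" for p t u f f'
  proof -
    obtain g where g: "tracks p t f g" using ex_tracks[OF p t f] by blast
    obtain h where h: "tracks t u f' h" using ex_tracks[OF t u f'] by blast
    have "g \<in> lifts (fst p) (fst t)" "h \<in> lifts (fst t) (fst u)" using g h by (simp_all add: tracks_def)
    then show ?thesis
      unfolding FHom_to_Lambda[OF p t g] FHom_to_Lambda[OF t u h]
        FHom_to_Lambda[OF p u tracks_comp(2)[OF p t u f g f' h]]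
      by (rule Comp_Lambda[symmetric])
  qed
  show "is_functor ?C Lambda_cat ?F"
    unfolding is_functor_def FO Id Co
    using OL FHom FIdent FComp by (simp add: Obj_Tw Ball_def)
  show "bij_betw (FHom ?F p t) (Hom ?C p t) (Hom Lambda_cat (FObj ?F p) (FObj ?F t))"
    if "p \<in> Obj ?C" "t \<in> Obj ?C" for p t
    unfolding bij_betw_def Hom_Lambda FO
  proof
    have p: "cyc_obj p" and t: "cyc_obj t" using that by (simp_all add: Obj_Tw)
    show "inj_on (FHom ?F p t) (Hom ?C p t)"
    proof (rule inj_onI)
      fix f f' assume *: "f \<in> Hom ?C p t" "f' \<in> Hom ?C p t" "FHom ?F p t f = FHom ?F p t f'"
      obtain g where g: "tracks p t f g" using ex_tracks[OF p t *(1)] by blast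
      moreover have "tracks p t f' g" using *(3) g by (auto simp: to_Lambda_def)
      ultimately show "f = f'" using tracks_inject[OF p *(1,2)] by blast
    qed
    show "FHom ?F p t ` Hom ?C p t = shift_class (fst t) ` lifts (fst p) (fst t)"
    proof (intro equalityI subsetI)
      fix G assume "G \<in> FHom ?F p t ` Hom ?C p t"
      then obtain f where f: "f \<in> Hom ?C p t" "G = FHom ?F p t f" by blast
      then obtain g where g: "tracks p t f g" using ex_tracks[OF p t] by blast
      then show "G \<in> shift_class (fst t) ` lifts (fst p) (fst t)"
        using FHom_to_Lambda[OF p t g] f(2) by (auto simp: tracks_def)
    next
      fix G assume "G \<in> shift_class (fst t) ` lifts (fst p) (fst t)"
      then obtain g where g: "g \<in> lifts (fst p) (fst t)" "G = shift_class (fst t) g" by blast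
      then obtain f where "f \<in> Hom ?C p t" "tracks p t f g" using ex_tracked[OF p t] by blast
      then show "G \<in> FHom ?F p t ` Hom ?C p t" using FHom_to_Lambda[OF p t] g(2) by blast
    qed
  qed
  show "\<exists>p\<in>Obj ?C. FObj ?F p = n" for n
    using cyclic_order_cyc[of "[0..<Suc n]"] unfolding FO
    by (intro bexI[of _ "(n, cyc [0..<Suc n])"]) (simp_all add: Obj_Tw atLeast0LessThan lessThan_Suc_atMost del: upt_Suc)
qed

end
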